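(* Let $X$ be a centered, nondegenerate, infinitely divisible real random variable with finite variance $V>0$. For every $v>0$, with $\theta=v/V$, $$c_*(v)=\max\Bigl\{0,\ \sup_{t>0}\Psi_\theta(t)\Bigr\},\qquad \Psi_\theta(t)=\frac1t\Bigl(1-\frac{\theta}{M_R(t)}\Bigr).$$ If the right-hand side is finite, it is itself feasible (that is, the pair $(v,c)$ with $c$ equal to the right-hand side is feasible for $X$); the infimum defining $c_*(v)$ is then attained and is a minimum.
   Context: Standing setting: $X$ is a centered, nondegenerate, infinitely divisible real random variable with variance $0<V=\mathrm{Var}(X)<\infty$, Gaussian variance $a\ge0$ and Lévy measure $\nu$ on $\mathbb{R}\setminus\{0\}$. For all real $t$, $K_X(t)=\log\mathbb{E}e^{tX}=\frac{at^2}{2}+\int_{\mathbb{R}\setminus\{0\}}(e^{tx}-1-tx)\,\nu(dx)\in[0,\infty]$, and $V=a+\int x^2\,\nu(dx)$. Let $H_X(dx)=a\delta_0(dx)+x^2\nu(dx)$ (a measure of total mass $V$), let $Z$ have law $H_X/V$, let $B\sim\mathrm{Beta}(1,2)$ (density $2(1-b)$ on $(0,1)$) be independent of $Z$, and put $R=BZ$, $M_R(t)=\mathbb{E}e^{tR}\in(0,\infty]$. Conventions: $1/0=\infty$, $1/\infty=0$, $\theta/\infty=0$ for finite $\theta$ (so $\Psi_\theta(t)=1/t$ when $M_R(t)=\infty$). A pair $(v,c)\in(0,\infty)\times[0,\infty)$ is feasible for $X$ if $K_X(t)\le \frac{vt^2}{2(1-ct)}$ for every $0\le t<1/c$ (for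 $c=0$: for all $t\ge0$). $c_*(v)=\inf\{c\ge0:(v,c)\text{ is feasible}\}\in[0,\infty]$, with $\inf\emptyset=\infty$. *)

theory Defs
  imports "HOL-Probability.Probability"
begin

definition infinitely_divisible :: "real measure \<Rightarrow> bool" where
  "infinitely_divisible \<mu> \<longleftrightarrow>
     (\<forall>n::nat. n \<ge> 1 \<longrightarrow> (\<exists>\<rho>. real_distribution \<rho> \<and>
        \<mu> = distr (Pi\<^sub>M {..<n} (\<lambda>_. \<rho>)) borel (\<lambda>x. \<Sum>i<n. x i)))"

text \<open>A measure on the punctured line is represented by a Borel measure on the line that does
  not charge the origin.\<close>

definition levy_measure :: "real measure \<Rightarrow> bool" where
  "levy_measure \<nu> \<longleftrightarrow>
     sets \<nu> = sets borel \<and> emeasure \<nu> {0} = 0 \<and>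
     (\<integral>\<^sup>+x. ennreal (min 1 (x\<^sup>2)) \<partial>\<nu>) < \<infinity>"

text \<open>The Levy-Khintchine representation with drift \<open>b\<close> (for the truncation function
  \<open>x \<mapsto> x\<close> on \<open>[-1, 1]\<close>), Gaussian variance \<open>a\<close> and Levy measure \<open>\<nu>\<close>. The last two do not
  depend on the choice of the truncation function.\<close>

definition has_levy_triplet :: "real measure \<Rightarrow> real \<Rightarrow> real \<Rightarrow> real measure \<Rightarrow> bool" where
  "has_levy_triplet \<mu> b a \<nu> \<longleftrightarrow>
     a \<ge> 0 \<and> levy_measure \<nu> \<and>
     (\<forall>u. char \<mu> u =
        exp (\<i> * complex_of_real (b * u) - complex_of_real (a * u\<^sup>2 / 2)
             + (CLINT x|\<nu>. iexp (u * x) - 1 - \<i> * complex_of_real (u * x * indicator {-1..1} x))))"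

definition mgf :: "'a measure \<Rightarrow> ('a \<Rightarrow> real) \<Rightarrow> real \<Rightarrow> ennreal" where
  "mgf M X t = (\<integral>\<^sup>+\<omega>. ennreal (exp (t * X \<omega>)) \<partial>M)"

definition cgf :: "'a measure \<Rightarrow> ('a \<Rightarrow> real) \<Rightarrow> real \<Rightarrow> ereal" where
  "cgf M X t = (if mgf M X t = \<infinity> then \<infinity> else ereal (ln (enn2real (mgf M X t))))"

definition feasible :: "'a measure \<Rightarrow> ('a \<Rightarrow> real) \<Rightarrow> real \<Rightarrow> real \<Rightarrow> bool" where
  "feasible M X v c \<longleftrightarrow>
     v > 0 \<and> c \<ge> 0 \<and>
     (\<forall>t\<ge>0. c = 0 \<or> t < 1 / c \<longrightarrow> cgf M X t \<le> ereal (v * t\<^sup>2 / (2 * (1 - c * t))))"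

definition c_star :: "'a measure \<Rightarrow> ('a \<Rightarrow> real) \<Rightarrow> real \<Rightarrow> ereal" where
  "c_star M X v = Inf {ereal c |c. feasible M X v c}"

text \<open>The measure \<open>a \<delta>\<^sub>0(dx) + x\<^sup>2 \<nu>(dx)\<close>.\<close>

definition levy_H :: "real \<Rightarrow> real measure \<Rightarrow> real measure" where
  "levy_H a \<nu> = measure_of UNIV (sets borel)
     (\<lambda>A. ennreal a * indicator A 0 + (\<integral>\<^sup>+x\<in>A. ennreal (x\<^sup>2) \<partial>\<nu>))"

lemma sets_levy_H [simp]: "sets (levy_H a \<nu>) = sets borel"
  unfolding levy_H_def using sets.sets_measure_of_eq[of "borel :: real measure"] by (simp only: space_borel)

text \<open>The set function above is countably additive, so \<open>measure_of\<close> does not degenerate to the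
  zero measure.\<close>

lemma emeasure_levy_H:
  assumes \<nu>: "sets \<nu> = sets borel" and A: "A \<in> sets borel"
  shows "emeasure (levy_H a \<nu>) A = ennreal a * indicator A 0 + (\<integral>\<^sup>+x\<in>A. ennreal (x\<^sup>2) \<partial>\<nu>)"
proof -
  let ?D = "density (return borel (0::real)) (\<lambda>_. ennreal a)"
  let ?E = "density \<nu> (\<lambda>x. ennreal (x\<^sup>2))"
  let ?f = "\<lambda>A. ennreal a * indicator A 0 + (\<integral>\<^sup>+x\<in>A. ennreal (x\<^sup>2) \<partial>\<nu>)"
  have meas: "(\<lambda>x. ennreal (x\<^sup>2)) \<in> borel_measurable \<nu>"
    unfolding measurable_cong_sets[OF \<nu> refl] by measurable
  have eq: "?f B = emeasure ?D B + emeasure ?E B" if "B \<in> sets borel" for B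
    using that \<nu> meas by (simp add: emeasure_density nn_integral_cmult nn_integral_return)
  have "countably_additive (sets borel) ?f"
  proof (rule countably_additiveI)
    fix F :: "nat \<Rightarrow> real set"
    assume F: "range F \<subseteq> sets borel" "disjoint_family F" "(\<Union>i. F i) \<in> sets borel"
    have "(\<Sum>i. ?f (F i)) = (\<Sum>i. emeasure ?D (F i) + emeasure ?E (F i))"
      using F(1) eq by (intro suminf_cong) blast
    also have "\<dots> = (\<Sum>i. emeasure ?D (F i)) + (\<Sum>i. emeasure ?E (F i))"
      by (rule suminf_add[symmetric]) auto
    also have "\<dots> = emeasure ?D (\<Union>i. F i) + emeasure ?E (\<Union>i. F i)"
      using F \<nu> by (simp add: suminf_emeasure)
    finally show "(\<Sum>i. ?f (F i)) = ?f (\<Union>i. F i)"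
      using eq[OF F(3)] by simp
  qed
  moreover have "positive (sets borel) ?f"
    by (simp add: positive_def)
  ultimately show ?thesis
    using A unfolding levy_H_def
    by (intro emeasure_measure_of_sigma)
       (use sets.sigma_algebra_axioms[of "borel :: real measure"] in auto)
qed

text \<open>With \<open>R = B Z\<close>, this is \<open>\<Psi>\<^sub>\<theta>(t) = (1 - \<theta> / M\<^sub>R(t)) / t\<close>; division in \<^typ>\<open>ereal\<close> satisfies
  \<open>\<theta> / \<infinity> = 0\<close> for finite \<open>\<theta>\<close>.\<close>

definition Psi :: "'b measure \<Rightarrow> ('b \<Rightarrow> real) \<Rightarrow> real \<Rightarrow> real \<Rightarrow> ereal" where
  "Psi N R \<theta> t = 1 / ereal t * (1 - ereal \<theta> / enn2ereal (mgf N R t))"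

end

theory Submission
  imports Defs "HOL-Real_Asymp.Real_Asymp"
begin

text \<open>
  Everything follows from the identity \<open>K\<^sub>X(t) = V t\<^sup>2 M\<^sub>R(t) / 2\<close> for \<open>t > 0\<close>, with both sides allowed
  to be infinite. Given it, the inequality \<open>K\<^sub>X(t) \<le> v t\<^sup>2 / (2 (1 - c t))\<close> is equivalent to
  \<open>\<Psi>\<^sub>\<theta>(t) \<le> c\<close> when \<open>c t < 1\<close>, and \<open>\<Psi>\<^sub>\<theta>(t) \<le> 1 / t \<le> c\<close> is automatic when \<open>c t \<ge> 1\<close>. So \<open>(v, c)\<close> is
  feasible iff \<open>c \<ge> 0\<close> bounds \<open>\<Psi>\<^sub>\<theta>\<close> from above (\<open>feasible_iff_Psi_le\<close>); the smallest such \<open>c\<close> is the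
  claimed maximum, and it belongs to the set as soon as it is finite.

  Let \<open>Q\<close> be the law of \<open>Z\<close>. By Taylor's formula with integral remainder
  (\<open>nn_integral_beta_exp\<close>), \<open>t\<^sup>2 M\<^sub>R(t) / 2\<close> is the integral of \<open>(e\<^bsup>t x\<^esup> - 1 - t x) / x\<^sup>2\<close> against \<open>Q\<close>, so
  the identity says that the exponent in the Levy-Khintchine formula may be evaluated at real
  arguments, and that it is finite exactly when the exponential moment of \<open>X\<close> is
  (\<open>nn_integral_exp_eq\<close>). The given formula only speaks about the characteristic function, from
  which one-sided exponential moments cannot be read off directly. The bridge is infinite
  divisibility.

  In law, \<open>X\<close> is a sum of \<open>n\<close> independent summands with law \<open>\<rho>\<^sub>n\<close>. These are centered, with second
  moment \<open>V / n\<close>, so \<open>Q\<^sub>n(dx) = n x\<^sup>2 \<rho>\<^sub>n(dx) / V\<close> is a probability measure. The characteristic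
  function of \<open>\<rho>\<^sub>n\<close> is \<open>exp (\<psi> / n)\<close>, where \<open>exp \<psi>\<close> is that of \<open>X\<close>; this gives convergence of
  the integrals of \<open>(e\<^bsup>\<i> u x\<^esup> - 1 - \<i> u x) / x\<^sup>2\<close> against \<open>Q\<^sub>n\<close> to those against \<open>Q\<close>. Second
  differences in \<open>u\<close> turn this into convergence of characteristic functions
  (\<open>char_tendsto_of_levy_kernel\<close>), hence \<open>Q\<^sub>n \<rightarrow> Q\<close> weakly by Levy's continuity theorem.

  Now cap every summand at a level \<open>K\<close>. The exponential moment of the capped sum is
  \<open>(1 + w\<^sub>n / n)\<^sup>n\<close>, where \<open>w\<^sub>n\<close> is the integral of a bounded continuous function against \<open>V Q\<^sub>n\<close>, so
  it converges. Capping decreases the sum, which bounds \<open>E e\<^bsup>t X\<^esup>\<close> from below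
  (\<open>nn_integral_exp_ge\<close>); and capping changes the sum with probability at most \<open>V / K\<^sup>2\<close> uniformly in
  \<open>n\<close>, which bounds \<open>E min (e\<^bsup>t X\<^esup>, L)\<close> from above (\<open>nn_integral_min_exp_le\<close>). Letting \<open>K \<rightarrow> \<infinity>\<close> and
  then \<open>L \<rightarrow> \<infinity>\<close> gives the identity.
\<close>

section \<open>Levy-Khintchine kernels\<close>

text \<open>The integrand of the Levy exponent, divided by the square of the jump, so that integrating it
  against \<open>a \<delta>\<^sub>0(dx) + x\<^sup>2 \<nu>(dx)\<close> yields the Gaussian and the jump part at once. The value at the
  origin is the continuous extension.\<close>

definition levy_kernel :: "real \<Rightarrow> real \<Rightarrow> complex" where
  "levy_kernel u x =
     (if x = 0 then - complex_of_real (u\<^sup>2 / 2)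
      else (iexp (u * x) - 1 - \<i> * complex_of_real (u * x)) / complex_of_real (x\<^sup>2))"

lemma measurable_levy_kernel [measurable]: "levy_kernel u \<in> borel_measurable borel"
  unfolding levy_kernel_def by measurable

lemma levy_kernel_mult_square:
  "complex_of_real (x\<^sup>2) * levy_kernel u x = iexp (u * x) - 1 - \<i> * complex_of_real (u * x)"
  by (simp add: levy_kernel_def)

lemma norm_iexp_remainder_le:
  "norm (iexp y - 1 - \<i> * complex_of_real y) \<le> y\<^sup>2 / 2"
  using iexp_approx1[of y 1] by (simp add: power2_eq_square numeral_2_eq_2 diff_diff_eq)

lemma norm_levy_kernel_le: "norm (levy_kernel u x) \<le> u\<^sup>2 / 2"
proof (cases "x = 0")
  case False
  then have "norm (levy_kernel u x) = norm (iexp (u * x) - 1 - \<i> * complex_of_real (u * x)) / x\<^sup>2"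
    by (simp add: levy_kernel_def norm_divide norm_power)
  also have "\<dots> \<le> ((u * x)\<^sup>2 / 2) / x\<^sup>2"
    by (intro divide_right_mono norm_iexp_remainder_le) auto
  finally show ?thesis using False by (simp add: power_mult_distrib)
qed (simp add: levy_kernel_def norm_divide norm_power)

lemma isCont_levy_kernel_param: "isCont (\<lambda>u. levy_kernel u x) u"
  unfolding levy_kernel_def by (cases "x = 0") (auto intro!: continuous_intros)

text \<open>Differencing twice in \<open>u\<close> plays the part of \<open>- d\<^sup>2/du\<^sup>2\<close>, which would turn the exponent into
  the characteristic function of the mixing law. Since \<open>2 (1 - cos (h x)) = 4 sin\<^sup>2 (h x / 2)\<close>,
  a finite step \<open>h\<close> only costs a weight with values in \<open>[0, 1]\<close> that tends to 1 as \<open>h \<rightarrow> 0\<close>.\<close>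

lemma levy_kernel_second_difference:
  "levy_kernel (u + h) x + levy_kernel (u - h) x - 2 * levy_kernel u x =
     - complex_of_real (h\<^sup>2) * (complex_of_real ((sinc (h / 2 * x))\<^sup>2) * iexp (u * x))"
proof (cases "x = 0")
  case True
  then show ?thesis
    by (simp add: levy_kernel_def power2_eq_square field_simps)
next
  case False
  \<comment> \<open>The affine part of the numerators cancels, and \<open>iexp (u * x)\<close> factors out of the rest.\<close>
  have e: "iexp ((u + h) * x) = iexp (u * x) * iexp (h * x)"
    "iexp ((u - h) * x) = iexp (u * x) * iexp (- (h * x))"
    by (simp_all add: exp_add [symmetric] algebra_simps)
  have s: "iexp (h * x) + iexp (- (h * x)) - 2 = - complex_of_real (4 * (sin (h / 2 * x))\<^sup>2)"
    using cos_double_sin[of "h / 2 * x"]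
    by (simp add: complex_eq_iff Re_exp Im_exp)
  have sinc: "h\<^sup>2 * (sinc (h / 2 * x))\<^sup>2 = 4 * (sin (h / 2 * x))\<^sup>2 / x\<^sup>2"
    using False by (auto simp: power_divide power_mult_distrib)
  have "levy_kernel (u + h) x + levy_kernel (u - h) x - 2 * levy_kernel u x =
      iexp (u * x) * (iexp (h * x) + iexp (- (h * x)) - 2) / complex_of_real (x\<^sup>2)"
    using False unfolding levy_kernel_def e by (simp add: field_simps)
  also have "\<dots> = - (complex_of_real (4 * (sin (h / 2 * x))\<^sup>2 / x\<^sup>2) * iexp (u * x))"
    unfolding s by simp
  finally show ?thesis
    unfolding sinc [symmetric] by (simp add: mult.assoc)
qed

definition exp_kernel :: "real \<Rightarrow> real" where
  "exp_kernel y = (if y = 0 then 1 / 2 else (exp y - 1 - y) / y\<^sup>2)"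

lemma exp_kernel_nonneg: "0 \<le> exp_kernel y"
proof -
  have "0 \<le> exp y - 1 - y" using exp_ge_add_one_self[of y] by linarith
  then show ?thesis by (auto simp: exp_kernel_def intro!: divide_nonneg_nonneg)
qed

lemma measurable_exp_kernel [measurable]: "exp_kernel \<in> borel_measurable borel"
  unfolding exp_kernel_def by measurable

lemma isCont_exp_kernel: "isCont exp_kernel y"
proof (cases "y = 0")
  case True
  have "((\<lambda>y::real. (exp y - 1 - y) / y\<^sup>2) \<longlongrightarrow> 1 / 2) (at 0)"
    by real_asymp
  then have "(exp_kernel \<longlongrightarrow> 1 / 2) (at 0)"
    by (rule Lim_transform_eventually) (auto simp: exp_kernel_def eventually_at_filter)
  then show ?thesis using True by (simp add: isCont_def exp_kernel_def)
next
  case False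
  have "eventually (\<lambda>z. z \<in> - {0}) (nhds y)"
    using False by (intro eventually_nhds_in_open) auto
  then have "eventually (\<lambda>z. exp_kernel z = (exp z - 1 - z) / z\<^sup>2) (nhds y)"
    by eventually_elim (simp add: exp_kernel_def)
  moreover have "isCont (\<lambda>z. (exp z - 1 - z) / z\<^sup>2) y"
    using False by (intro continuous_intros) auto
  ultimately show ?thesis by (simp add: isCont_cong)
qed

text \<open>On \<open>[-c, c]\<close> the kernel is at most \<open>e\<^sup>c / 2\<close> by Taylor's formula; further left its numerator grows
  only linearly, so it is at most 1.\<close>

lemma exp_kernel_le:
  assumes "y \<le> c" "1 \<le> c"
  shows "exp_kernel y \<le> exp c"
proof (cases "\<bar>y\<bar> \<le> c")
  case True
  obtain s where s: "\<bar>s\<bar> \<le> \<bar>y\<bar>" "exp y = (\<Sum>m<2. y ^ m / fact m) + exp s / fact 2 * y ^ 2"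
    using Maclaurin_exp_le[of y 2] by blast
  have "exp s \<le> exp (max s 0) * 2" "1 \<le> exp (max s 0) * 2"
    using order_trans[of "exp s" "exp (max s 0)"] order_trans[of 1 "exp (max s 0)"] by auto
  then have "exp_kernel y \<le> exp (max s 0)"
    using s(2) by (auto simp: exp_kernel_def numeral_2_eq_2)
  also have "\<dots> \<le> exp c" using s(1) True by auto
  finally show ?thesis .
next
  case False
  then have y: "y < -1" using assms by auto
  have "exp y - 1 - y \<le> y\<^sup>2"
  proof -
    have "exp y \<le> 1" using y by simp
    moreover have "- y \<le> y\<^sup>2" using y mult_left_mono_neg[of y "-1" y] by (simp add: power2_eq_square)
    ultimately show ?thesis by linarith
  qed
  then have "exp_kernel y \<le> 1" using y by (simp add: exp_kernel_def divide_le_eq_1)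
  also have "1 \<le> exp c" using assms by simp
  finally show ?thesis .
qed

text \<open>This is Taylor's formula with integral remainder; it explains why the law \<open>Beta(1, 2)\<close> appears.\<close>

lemma nn_integral_beta_exp:
  "(\<integral>\<^sup>+x. ennreal (2 * (1 - x) * indicator {0<..<1} x) * ennreal (exp (x * y)) \<partial>lborel) =
     ennreal (2 * exp_kernel y)"
proof -
  let ?f = "\<lambda>x. 2 * (1 - x) * exp (x * y)"
  have "(\<integral>\<^sup>+x. ennreal (2 * (1 - x) * indicator {0<..<1} x) * ennreal (exp (x * y)) \<partial>lborel) =
      (\<integral>\<^sup>+x. ennreal (?f x) * indicator {0..1} x \<partial>lborel)"
  proof (rule nn_integral_cong_AE)
    have "AE x in lborel. x \<noteq> (0::real)" by (rule AE_lborel_singleton)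
    moreover have "AE x in lborel. x \<noteq> (1::real)" by (rule AE_lborel_singleton)
    ultimately show "AE x in lborel. ennreal (2 * (1 - x) * indicator {0<..<1} x) * ennreal (exp (x * y))
        = ennreal (?f x) * indicator {0..1} x"
      by eventually_elim (auto simp: indicator_def ennreal_mult')
  qed
  also have "\<dots> = ennreal (2 * exp_kernel y)"
  proof (cases "y = 0")
    case True
    have "(\<integral>\<^sup>+x. ennreal (?f x) * indicator {0..1} x \<partial>lborel) =
        ennreal ((2 * 1 - 1\<^sup>2) - (2 * 0 - 0\<^sup>2))"
      using True
      by (intro nn_integral_FTC_Icc[where F = "\<lambda>x. 2 * x - x\<^sup>2"])
         (auto intro!: derivative_eq_intros)
    then show ?thesis using True by (simp add: exp_kernel_def)
  next
    case False
    \<comment> \<open>\<open>?F\<close> comes from one integration by parts.\<close>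
    let ?F = "\<lambda>x. (2 * (1 - x) / y + 2 / y\<^sup>2) * exp (x * y)"
    have "(\<integral>\<^sup>+x. ennreal (?f x) * indicator {0..1} x \<partial>lborel) = ennreal (?F 1 - ?F 0)"
      using False
      by (intro nn_integral_FTC_Icc[where F = ?F])
         (auto intro!: derivative_eq_intros simp: field_simps power2_eq_square)
    also have "?F 1 - ?F 0 = 2 * exp_kernel y"
      using False by (simp add: exp_kernel_def field_simps power2_eq_square)
    finally show ?thesis .
  qed
  finally show ?thesis .
qed

text \<open>The kernel of the exponent at the real argument \<open>t\<close>, with the exponential, but not the linear
  compensator, capped at the level \<open>K\<close>. The cap makes it bounded, hence a test function for weak
  convergence; leaving the compensator uncapped lets the zero mean of the summands remove it.\<close>

definition trunc_kernel :: "real \<Rightarrow> real \<Rightarrow> real \<Rightarrow> real" where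
  "trunc_kernel t K x = (if x = 0 then t\<^sup>2 / 2 else (exp (t * min x K) - 1 - t * x) / x\<^sup>2)"

lemma measurable_trunc_kernel [measurable]: "trunc_kernel t K \<in> borel_measurable borel"
  unfolding trunc_kernel_def by measurable

lemma trunc_kernel_mult_square:
  assumes "0 < K"
  shows "x\<^sup>2 * trunc_kernel t K x = exp (t * min x K) - 1 - t * x"
  using assms by (simp add: trunc_kernel_def)

lemma trunc_kernel_eq_exp_kernel:
  assumes "x \<le> K"
  shows "trunc_kernel t K x = t\<^sup>2 * exp_kernel (t * x)"
  using assms by (auto simp: trunc_kernel_def exp_kernel_def power_mult_distrib min_def)

lemma trunc_kernel_le_exp_kernel:
  assumes "0 \<le> t" "0 < K"
  shows "trunc_kernel t K x \<le> t\<^sup>2 * exp_kernel (t * x)"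
proof (cases "x \<le> K")
  case False
  have "trunc_kernel t K x \<le> trunc_kernel t x x"
    using assms False by (auto simp: trunc_kernel_def intro!: divide_right_mono mult_left_mono)
  then show ?thesis by (simp add: trunc_kernel_eq_exp_kernel)
qed (simp add: trunc_kernel_eq_exp_kernel)

text \<open>Above \<open>K\<close> the uncapped compensator can make the kernel negative, but by no more than
  \<open>t x / x\<^sup>2 \<le> t / K\<close>. Adding this vanishing constant makes Fatou's lemma applicable as
  \<open>K \<rightarrow> \<infinity>\<close>.\<close>

lemma trunc_kernel_ge:
  assumes "0 \<le> t" "0 < K"
  shows "- (t / K) \<le> trunc_kernel t K x"
proof (cases "x \<le> K")
  case True
  have "- (t / K) \<le> 0" using assms by simp
  also have "0 \<le> trunc_kernel t K x"
    using True by (simp add: trunc_kernel_eq_exp_kernel exp_kernel_nonneg)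
  finally show ?thesis .
next
  case False
  then have x: "0 < x" "K < x" using assms by auto
  have "- (t / K) \<le> - (t / x)" using assms x by (auto intro!: divide_left_mono)
  also have "\<dots> = (1 - 1 - t * x) / x\<^sup>2" using x by (simp add: power2_eq_square)
  also have "\<dots> \<le> (exp (t * min x K) - 1 - t * x) / x\<^sup>2"
    using assms x by (intro divide_right_mono diff_right_mono) auto
  finally show ?thesis using x by (simp add: trunc_kernel_def)
qed

lemma trunc_kernel_bounded:
  assumes "0 \<le> t" "1 \<le> K"
  shows "\<exists>C. \<forall>x. norm (trunc_kernel t K x) \<le> C"
proof -
  let ?C = "t\<^sup>2 * exp (1 + t * K) + exp (t * K)"
  have upper: "trunc_kernel t K x \<le> ?C" for x
  proof (cases "x \<le> K")
    case True
    have "t * x \<le> 1 + t * K" using True assms mult_left_mono[of x K t] by simp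
    then have "exp_kernel (t * x) \<le> exp (1 + t * K)"
      using assms by (intro exp_kernel_le) auto
    then have "t\<^sup>2 * exp_kernel (t * x) \<le> t\<^sup>2 * exp (1 + t * K)" by (intro mult_left_mono) auto
    then show ?thesis using True by (simp add: trunc_kernel_eq_exp_kernel add_increasing2)
  next
    case False
    then have x: "1 \<le> x" "1 \<le> x\<^sup>2" using assms by (auto simp: one_le_power)
    have "exp (t * K) - 1 - t * x \<le> exp (t * K)" using mult_nonneg_nonneg[of t x] assms(1) x(1) by linarith
    also have "\<dots> \<le> exp (t * K) * x\<^sup>2" using x by simp
    finally have "trunc_kernel t K x \<le> exp (t * K)"
      using False x by (simp add: trunc_kernel_def divide_le_eq)
    then show ?thesis by (simp add: add_increasing)
  qed
  have "norm (trunc_kernel t K x) \<le> ?C + t" for x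
  proof -
    have "t / K \<le> t" using assms mult_left_mono[of 1 K t] by (simp add: divide_le_eq)
    moreover have "0 \<le> ?C" by (intro add_nonneg_nonneg) auto
    ultimately have "- trunc_kernel t K x \<le> ?C + t" "trunc_kernel t K x \<le> ?C + t"
      using upper[of x] trunc_kernel_ge[of t K x] assms by linarith+
    then show ?thesis by simp
  qed
  then show ?thesis by blast
qed

lemma isCont_trunc_kernel:
  assumes "0 < K"
  shows "isCont (trunc_kernel t K) x"
proof (cases "x = 0")
  case True
  have "eventually (\<lambda>z. z \<in> {..<K}) (nhds x)"
    using True assms by (intro eventually_nhds_in_open) auto
  then have "eventually (\<lambda>z. trunc_kernel t K z = t\<^sup>2 * exp_kernel (t * z)) (nhds x)"
    by eventually_elim (simp add: trunc_kernel_eq_exp_kernel)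
  moreover have "isCont (\<lambda>z. t\<^sup>2 * exp_kernel (t * z)) x"
    by (intro continuous_intros isCont_o2[OF _ isCont_exp_kernel])
  ultimately show ?thesis by (simp add: isCont_cong)
next
  case False
  have "eventually (\<lambda>z. z \<in> - {0}) (nhds x)"
    using False by (intro eventually_nhds_in_open) auto
  then have "eventually (\<lambda>z. trunc_kernel t K z = (exp (t * min z K) - 1 - t * z) / z\<^sup>2) (nhds x)"
    by eventually_elim (simp add: trunc_kernel_def)
  moreover have "isCont (\<lambda>z. (exp (t * min z K) - 1 - t * z) / z\<^sup>2) x"
    using False by (intro continuous_intros) auto
  ultimately show ?thesis by (simp add: isCont_cong)
qed

section \<open>Sums of independent copies\<close>

text \<open>By Fubini \<open>(X + y)\<^sup>2\<close> is integrable for almost every value \<open>y\<close> of \<open>Y\<close>; one such \<open>y\<close> suffices,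
  because \<open>x\<^sup>2 \<le> 2 (x + y)\<^sup>2 + 2 y\<^sup>2\<close>.\<close>

lemma (in prob_space) integrable_square_of_indep_sum:
  fixes X Y :: "'a \<Rightarrow> real"
  assumes indep: "indep_var borel X borel Y"
    and sq: "integrable M (\<lambda>\<omega>. (X \<omega> + Y \<omega>)\<^sup>2)"
  shows "integrable M (\<lambda>\<omega>. (X \<omega>)\<^sup>2)"
proof -
  have [measurable]: "random_variable borel X" "random_variable borel Y"
    using indep by (auto dest: indep_var_rv1 indep_var_rv2)
  let ?DX = "distr M borel X" and ?DY = "distr M borel Y"
  interpret DX: prob_space ?DX by (rule prob_space_distr) measurable
  interpret DY: prob_space ?DY by (rule prob_space_distr) measurable
  interpret DXY: pair_prob_space ?DX ?DY ..
  have "integrable (?DX \<Otimes>\<^sub>M ?DY) (\<lambda>(x, y). (x + y)\<^sup>2)"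
    using indep sq unfolding indep_var_distribution_eq
    by (simp add: integrable_distr_eq split_beta')
  then have "AE y in ?DY. integrable ?DX (\<lambda>x. (x + y)\<^sup>2)"
    by (rule DXY.AE_integrable_snd)
  then obtain y where y: "integrable ?DX (\<lambda>x. (x + y)\<^sup>2)"
    using DY.AE_prob_1 eventually_happens[of _ "ae_filter ?DY"] DY.ae_filter_bot by auto
  have "integrable ?DX (\<lambda>x. x\<^sup>2)"
  proof (rule Bochner_Integration.integrable_bound)
    show "integrable ?DX (\<lambda>x. 2 * (x + y)\<^sup>2 + 2 * y\<^sup>2)" using y by simp
    have "x\<^sup>2 \<le> 2 * (x + y)\<^sup>2 + 2 * y\<^sup>2" for x
      using zero_le_power2[of "x + 2 * y"] by (simp add: power2_eq_square algebra_simps)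
    then show "AE x in ?DX. norm (x\<^sup>2) \<le> norm (2 * (x + y)\<^sup>2 + 2 * y\<^sup>2)"
      by (intro AE_I2) simp
  qed simp
  then show ?thesis by (simp add: integrable_distr_eq)
qed

locale iid_copies = real_distribution \<rho> for \<rho> :: "real measure" +
  fixes n :: nat
  assumes n_pos: "1 \<le> n"
begin

abbreviation P :: "(nat \<Rightarrow> real) measure" where
  "P \<equiv> Pi\<^sub>M {..<n} (\<lambda>_. \<rho>)"

sublocale P: prob_space P
  by (intro prob_space_PiM prob_space_axioms)

lemma measurable_coord [measurable]: "i < n \<Longrightarrow> (\<lambda>x. x i) \<in> borel_measurable P"
  using measurable_component_singleton[of i "{..<n}" "\<lambda>_. \<rho>"]
  by (simp add: measurable_cong_sets[OF refl events_eq_borel])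

lemma distr_coord:
  assumes "i < n"
  shows "distr P borel (\<lambda>x. x i) = \<rho>"
proof -
  have "distr P borel (\<lambda>x. x i) = distr P \<rho> (\<lambda>x. x i)"
    by (rule distr_cong) auto
  also have "\<dots> = \<rho>"
    using assms by (intro distr_PiM_component prob_space_axioms) auto
  finally show ?thesis .
qed

lemma indep_coords: "P.indep_vars (\<lambda>_. borel) (\<lambda>i x. x i) {..<n}"
proof (subst P.indep_vars_iff_distr_eq_PiM')
  have "distr P (Pi\<^sub>M {..<n} (\<lambda>_. borel)) (\<lambda>x. \<lambda>i\<in>{..<n}. x i) = distr P P (\<lambda>x. x)"
    by (intro distr_cong sets_PiM_cong) (auto simp: space_PiM)
  also have "\<dots> = P" by (rule distr_id)
  also have "\<dots> = Pi\<^sub>M {..<n} (\<lambda>i. distr P borel (\<lambda>x. x i))"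
    by (intro PiM_cong) (auto simp: distr_coord)
  finally show "distr P (Pi\<^sub>M {..<n} (\<lambda>_. borel)) (\<lambda>x. \<lambda>i\<in>{..<n}. x i) =
      Pi\<^sub>M {..<n} (\<lambda>i. distr P borel (\<lambda>x. x i))" .
qed (use n_pos in \<open>auto simp: lessThan_empty_iff\<close>)

lemma char_sum: "char (distr P borel (\<lambda>x. \<Sum>i<n. x i)) u = char \<rho> u ^ n"
  using P.char_distr_sum[OF indep_coords, of u] by (simp add: distr_coord)

lemma integral_coord:
  fixes f :: "real \<Rightarrow> real"
  assumes [measurable]: "f \<in> borel_measurable borel" and "i < n"
  shows "integral\<^sup>L P (\<lambda>x. f (x i)) = integral\<^sup>L \<rho> f"
    and "integrable P (\<lambda>x. f (x i)) \<longleftrightarrow> integrable \<rho> f"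
  using integral_distr[of "\<lambda>x. x i" P borel f] integrable_distr_eq[of "\<lambda>x. x i" P borel f]
    distr_coord[OF assms(2)] measurable_coord[OF assms(2)] by simp_all

lemma nn_integral_coord:
  assumes [measurable]: "f \<in> borel_measurable borel" and "i < n"
  shows "(\<integral>\<^sup>+x. f (x i) \<partial>P) = (\<integral>\<^sup>+x. f x \<partial>\<rho>)"
  using nn_integral_distr[of "\<lambda>x. x i" P borel f] distr_coord[OF assms(2)] measurable_coord[OF assms(2)]
  by simp

lemma nn_integral_exp_sum:
  assumes [measurable]: "f \<in> borel_measurable borel"
  shows "(\<integral>\<^sup>+x. ennreal (exp (\<Sum>i<n. f (x i))) \<partial>P) = (\<integral>\<^sup>+x. ennreal (exp (f x)) \<partial>\<rho>) ^ n"
proof -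
  have "(\<integral>\<^sup>+x. ennreal (exp (\<Sum>i<n. f (x i))) \<partial>P) = (\<integral>\<^sup>+x. (\<Prod>i<n. ennreal (exp (f (x i)))) \<partial>P)"
    by (simp add: exp_sum prod_ennreal)
  also have "\<dots> = (\<Prod>i<n. \<integral>\<^sup>+x. ennreal (exp (f (x i))) \<partial>P)"
    using P.indep_vars_compose2[OF indep_coords, of "\<lambda>_ x. ennreal (exp (f x))" "\<lambda>_. borel"]
    by (intro P.indep_vars_nn_integral) auto
  also have "\<dots> = (\<Prod>i<n. \<integral>\<^sup>+x. ennreal (exp (f x)) \<partial>\<rho>)"
    using nn_integral_coord[of "\<lambda>x. ennreal (exp (f x))"] by (intro prod.cong) auto
  finally show ?thesis by simp
qed

lemma integrable_square_of_sum:
  assumes "integrable P (\<lambda>x. (\<Sum>i<n. x i)\<^sup>2)"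
  shows "integrable \<rho> (\<lambda>x. x\<^sup>2)"
proof -
  have n0: "0 < n" using n_pos by simp
  have ins: "{..<n} = insert 0 {1..<n}" using n_pos by auto
  have "P.indep_var borel (\<lambda>x. x 0) borel (\<lambda>x. \<Sum>i\<in>{1..<n}. x i)"
  proof (rule P.indep_vars_sum)
    show "P.indep_vars (\<lambda>_. borel) (\<lambda>i x. x i) (insert 0 {1..<n})"
      by (subst ins [symmetric]) (rule indep_coords)
  qed auto
  moreover have "(\<Sum>i<n. x i) = x 0 + (\<Sum>i\<in>{1..<n}. x i)" for x :: "nat \<Rightarrow> real"
    unfolding ins by (subst sum.insert) auto
  ultimately have "integrable P (\<lambda>x. (x 0)\<^sup>2)"
    using assms P.integrable_square_of_indep_sum by simp
  then show ?thesis using integral_coord(2)[of "\<lambda>x. x\<^sup>2", OF _ n0] by simp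
qed

lemma expectation_sum:
  assumes "integrable \<rho> (\<lambda>x. x)"
  shows "integral\<^sup>L P (\<lambda>x. \<Sum>i<n. x i) = n * integral\<^sup>L \<rho> (\<lambda>x. x)"
proof -
  have *: "integrable P (\<lambda>x. x i)" "integral\<^sup>L P (\<lambda>x. x i) = integral\<^sup>L \<rho> (\<lambda>x. x)"
    if "i < n" for i
    using integral_coord[OF measurable_ident_sets[OF refl] that] assms by simp_all
  have "integral\<^sup>L P (\<lambda>x. \<Sum>i<n. x i) = (\<Sum>i<n. integral\<^sup>L P (\<lambda>x. x i))"
    using * by (intro Bochner_Integration.integral_sum) simp
  also have "\<dots> = (\<Sum>i<n. integral\<^sup>L \<rho> (\<lambda>x. x))"
    using * by (intro sum.cong) simp_all
  finally show ?thesis by simp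
qed

text \<open>Bienayme's identity: the mixed terms factor by independence and vanish by centering.\<close>

lemma expectation_square_sum:
  assumes sq: "integrable \<rho> (\<lambda>x. x\<^sup>2)" and mean: "integral\<^sup>L \<rho> (\<lambda>x. x) = 0"
  shows "integral\<^sup>L P (\<lambda>x. (\<Sum>i<n. x i)\<^sup>2) = n * integral\<^sup>L \<rho> (\<lambda>x. x\<^sup>2)"
proof -
  have int: "integrable \<rho> (\<lambda>x. x)"
    using square_integrable_imp_integrable[of "\<lambda>x. x"] sq by simp
  have *: "integrable P (\<lambda>x. x i * x j) \<and>
      integral\<^sup>L P (\<lambda>x. x i * x j) = (if i = j then integral\<^sup>L \<rho> (\<lambda>x. x\<^sup>2) else 0)"
    if ij: "i < n" "j < n" for i j
  proof (cases "i = j")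
    case True
    then show ?thesis using integral_coord[of "\<lambda>x. x\<^sup>2" j] ij sq by (simp add: power2_eq_square)
  next
    case False
    have "P.indep_vars (\<lambda>_. borel) (\<lambda>i x. x i) (insert i {j})"
      using ij by (intro P.indep_vars_subset[OF indep_coords]) auto
    then have "P.indep_var borel (\<lambda>x. x i) borel (\<lambda>x. \<Sum>j\<in>{j}. x j)"
      using False by (intro P.indep_vars_sum) simp_all
    then have "P.indep_var borel (\<lambda>x. x i) borel (\<lambda>x. x j)"
      by (simp only: sum.insert finite.emptyI sum.empty empty_iff not_False_eq_True add_0_right)
    moreover have "integrable P (\<lambda>x. x i)" "integrable P (\<lambda>x. x j)"
      using integral_coord(2)[OF measurable_ident_sets[OF refl] ij(1)]
        integral_coord(2)[OF measurable_ident_sets[OF refl] ij(2)] int by simp_all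
    ultimately have "integrable P (\<lambda>x. x i * x j)"
      and "integral\<^sup>L P (\<lambda>x. x i * x j) = integral\<^sup>L P (\<lambda>x. x i) * integral\<^sup>L P (\<lambda>x. x j)"
      by (rule P.indep_var_integrable, rule P.indep_var_lebesgue_integral)
    moreover have "integral\<^sup>L P (\<lambda>x. x i) = 0"
      using integral_coord(1)[of "\<lambda>x. x" i] ij mean by simp
    ultimately show ?thesis using False by simp
  qed
  have "integral\<^sup>L P (\<lambda>x. (\<Sum>i<n. x i)\<^sup>2) = integral\<^sup>L P (\<lambda>x. \<Sum>i<n. \<Sum>j<n. x i * x j)"
    by (simp add: power2_eq_square sum_product)
  also have "\<dots> = (\<Sum>i<n. \<Sum>j<n. integral\<^sup>L P (\<lambda>x. x i * x j))"
  proof (subst Bochner_Integration.integral_sum)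
    show "(\<Sum>i<n. integral\<^sup>L P (\<lambda>x. \<Sum>j<n. x i * x j)) = (\<Sum>i<n. \<Sum>j<n. integral\<^sup>L P (\<lambda>x. x i * x j))"
      using * by (intro sum.cong refl Bochner_Integration.integral_sum) auto
  qed (use * in \<open>intro Bochner_Integration.integrable_sum, auto\<close>)
  also have "\<dots> = (\<Sum>i<n. integral\<^sup>L \<rho> (\<lambda>x. x\<^sup>2))"
  proof (rule sum.cong)
    fix i assume i: "i \<in> {..<n}"
    have "(\<Sum>j<n. integral\<^sup>L P (\<lambda>x. x i * x j)) = (\<Sum>j<n. if i = j then integral\<^sup>L \<rho> (\<lambda>x. x\<^sup>2) else 0)"
      using * i by (intro sum.cong) auto
    then show "(\<Sum>j<n. integral\<^sup>L P (\<lambda>x. x i * x j)) = integral\<^sup>L \<rho> (\<lambda>x. x\<^sup>2)"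
      using i by simp
  qed simp
  finally show ?thesis by simp
qed

end

section \<open>Weak convergence from Levy exponents\<close>

lemma (in real_distribution) integrable_levy_kernel: "integrable M (levy_kernel u)"
proof (rule integrable_const_bound)
  show "AE x in M. norm (levy_kernel u x) \<le> u\<^sup>2 / 2"
    by (intro AE_I2 norm_levy_kernel_le)
qed simp

lemma sinc_square_le_1: "(sinc y)\<^sup>2 \<le> 1"
  using abs_sin_x_le_abs_x[of y] by (auto simp: power_le_one_iff abs_square_le_1 divide_le_eq_1)

lemma norm_sinc_square_le_1: "norm ((sinc y)\<^sup>2) \<le> 1"
  using sinc_square_le_1[of y] by (simp only: real_norm_def abs_of_nonneg[OF zero_le_power2])

text \<open>A characteristic function is approximated by its weighted version, which the Levy kernels
  determine; the error is controlled by the mass that the weight removes, uniformly in \<open>u\<close>.\<close>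

lemma (in real_distribution) sinc_weighted_char:
  "integrable M (\<lambda>x. complex_of_real ((sinc (h / 2 * x))\<^sup>2) * iexp (u * x))"
  "- complex_of_real (h\<^sup>2) * (CLINT x|M. complex_of_real ((sinc (h / 2 * x))\<^sup>2) * iexp (u * x)) =
     integral\<^sup>L M (levy_kernel (u + h)) + integral\<^sup>L M (levy_kernel (u - h)) -
     2 * integral\<^sup>L M (levy_kernel u)"
  "norm (char M u - (CLINT x|M. complex_of_real ((sinc (h / 2 * x))\<^sup>2) * iexp (u * x))) \<le>
     1 - (LINT x|M. (sinc (h / 2 * x))\<^sup>2)"
proof -
  have bound: "(sinc y)\<^sup>2 \<le> 1" for y by (rule sinc_square_le_1)
  have nb: "norm (complex_of_real r * iexp z) \<le> 1" if "0 \<le> r" "r \<le> 1" for r z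
    using that by (simp add: norm_mult)
  have norm_diff: "norm (iexp z - complex_of_real r * iexp z) = 1 - r" if "r \<le> 1" for r z
  proof -
    have "iexp z - complex_of_real r * iexp z = complex_of_real (1 - r) * iexp z"
      by (simp add: left_diff_distrib)
    then show ?thesis using that by (simp only: norm_mult norm_of_real norm_exp_i_times) simp
  qed
  show int: "integrable M (\<lambda>x. complex_of_real ((sinc (h / 2 * x))\<^sup>2) * iexp (u * x))" for u
    by (rule integrable_const_bound[where B = 1], rule AE_I2, rule nb[OF _ bound]) simp_all
  have int': "integrable M (\<lambda>x. (sinc (h / 2 * x))\<^sup>2)"
    by (rule integrable_const_bound[where B = 1], intro AE_I2 norm_sinc_square_le_1) measurable
  have lk: "integrable M (levy_kernel u)" for u
    by (rule integrable_levy_kernel)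
  have "- complex_of_real (h\<^sup>2) * (CLINT x|M. complex_of_real ((sinc (h / 2 * x))\<^sup>2) * iexp (u * x)) =
      (CLINT x|M. - complex_of_real (h\<^sup>2) * (complex_of_real ((sinc (h / 2 * x))\<^sup>2) * iexp (u * x)))"
    by (rule integral_mult_right_zero [symmetric])
  also have "\<dots> = (CLINT x|M. levy_kernel (u + h) x + levy_kernel (u - h) x - 2 * levy_kernel u x)"
    by (simp only: levy_kernel_second_difference)
  also have "\<dots> = integral\<^sup>L M (levy_kernel (u + h)) + integral\<^sup>L M (levy_kernel (u - h)) -
     2 * integral\<^sup>L M (levy_kernel u)"
    using lk by (simp add: Bochner_Integration.integral_diff Bochner_Integration.integral_add)
  finally show "- complex_of_real (h\<^sup>2) * (CLINT x|M. complex_of_real ((sinc (h / 2 * x))\<^sup>2) * iexp (u * x)) =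
     integral\<^sup>L M (levy_kernel (u + h)) + integral\<^sup>L M (levy_kernel (u - h)) -
     2 * integral\<^sup>L M (levy_kernel u)" .
  let ?f = "\<lambda>x. iexp (u * x) - complex_of_real ((sinc (h / 2 * x))\<^sup>2) * iexp (u * x)"
  have "char M u - (CLINT x|M. complex_of_real ((sinc (h / 2 * x))\<^sup>2) * iexp (u * x)) = integral\<^sup>L M ?f"
    unfolding char_def using int integrable_iexp[of "\<lambda>x. u * x"]
    by (intro Bochner_Integration.integral_diff [symmetric]) auto
  moreover have "norm (integral\<^sup>L M ?f) \<le> (LINT x|M. norm (?f x))"
    by (rule integral_norm_bound)
  moreover have "(LINT x|M. norm (?f x)) = (LINT x|M. 1 - (sinc (h / 2 * x))\<^sup>2)"
    by (simp only: norm_diff[OF sinc_square_le_1])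
  moreover have "(LINT x|M. 1 - (sinc (h / 2 * x))\<^sup>2) = 1 - (LINT x|M. (sinc (h / 2 * x))\<^sup>2)"
    using int' prob_space by (subst Bochner_Integration.integral_diff) simp_all
  ultimately show "norm (char M u - (CLINT x|M. complex_of_real ((sinc (h / 2 * x))\<^sup>2) * iexp (u * x))) \<le>
     1 - (LINT x|M. (sinc (h / 2 * x))\<^sup>2)"
    by (simp only:)
qed

lemma (in real_distribution) sinc_weight_mass_tendsto:
  "(\<lambda>k. LINT x|M. (sinc (1 / real (Suc k) / 2 * x))\<^sup>2) \<longlonglongrightarrow> 1"
proof -
  have "(\<lambda>k. LINT x|M. (sinc (1 / real (Suc k) / 2 * x))\<^sup>2) \<longlonglongrightarrow> (LINT x|M. 1)"
  proof (rule integral_dominated_convergence[where w = "\<lambda>_. 1"])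
    show "AE x in M. (\<lambda>k. (sinc (1 / real (Suc k) / 2 * x))\<^sup>2) \<longlonglongrightarrow> 1"
    proof (rule AE_I2)
      fix x
      have "(\<lambda>k. 1 / real (Suc k) / 2 * x) \<longlonglongrightarrow> 0 / 2 * x"
        using LIMSEQ_inverse_real_of_nat
        by (intro tendsto_mult tendsto_divide tendsto_const) (simp_all add: inverse_eq_divide)
      then have "(\<lambda>k. sinc (1 / real (Suc k) / 2 * x)) \<longlonglongrightarrow> sinc (0 / 2 * x)"
        by (rule isCont_tendsto_compose[OF isCont_sinc])
      then have "(\<lambda>k. (sinc (1 / real (Suc k) / 2 * x))\<^sup>2) \<longlonglongrightarrow> (sinc (0 / 2 * x))\<^sup>2"
        by (rule tendsto_power)
      then show "(\<lambda>k. (sinc (1 / real (Suc k) / 2 * x))\<^sup>2) \<longlonglongrightarrow> 1" by simp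
    qed
    show "AE x in M. norm ((sinc (1 / real (Suc k) / 2 * x))\<^sup>2) \<le> 1" for k
      by (intro AE_I2 norm_sinc_square_le_1)
  qed simp_all
  then show ?thesis using prob_space by simp
qed

text \<open>For fixed \<open>h\<close> the weighted characteristic functions converge by the second difference. The
  errors of the approximation are \<open>1 - w\<close>, where the mass \<open>w\<close> is the weighted characteristic
  function at 0; it therefore converges as well, and its limit is close to 1 for small \<open>h\<close>.\<close>

lemma char_tendsto_of_levy_kernel:
  assumes Qn: "\<And>n. real_distribution (Qn n)" and Q: "real_distribution Q"
    and conv: "\<And>u. (\<lambda>n. integral\<^sup>L (Qn n) (levy_kernel u)) \<longlonglongrightarrow> integral\<^sup>L Q (levy_kernel u)"
  shows "(\<lambda>n. char (Qn n) u) \<longlonglongrightarrow> char Q u"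
proof (rule LIMSEQ_I)
  fix e :: real
  assume e: "0 < e"
  interpret Q: real_distribution Q by (rule Q)
  interpret Qn: real_distribution "Qn n" for n by (rule Qn)
  define W where "W D h u = (CLINT x|D. complex_of_real ((sinc (h / 2 * x))\<^sup>2) * iexp (u * x))"
    for D h u
  define w where "w D h = (LINT x|D. (sinc (h / 2 * x))\<^sup>2)" for D :: "real measure" and h
  have w_W: "complex_of_real (w D h) = W D h 0" for D h
    by (simp add: w_def W_def flip: integral_complex_of_real)
  have W_tendsto: "(\<lambda>n. W (Qn n) h u) \<longlonglongrightarrow> W Q h u" if "h \<noteq> 0" for h u
  proof -
    have "(\<lambda>n. - complex_of_real (h\<^sup>2) * W (Qn n) h u) \<longlonglongrightarrow> - complex_of_real (h\<^sup>2) * W Q h u"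
      unfolding W_def Q.sinc_weighted_char(2) Qn.sinc_weighted_char(2)
      by (intro tendsto_intros conv)
    then have "(\<lambda>n. - complex_of_real (h\<^sup>2) * W (Qn n) h u / (- complex_of_real (h\<^sup>2)))
        \<longlonglongrightarrow> - complex_of_real (h\<^sup>2) * W Q h u / (- complex_of_real (h\<^sup>2))"
      using that by (intro tendsto_divide tendsto_const) auto
    then show ?thesis using that by simp
  qed
  obtain h where h: "h \<noteq> 0" "\<bar>w Q h - 1\<bar> < e / 6"
  proof -
    obtain k where "norm (w Q (1 / real (Suc k)) - 1) < e / 6"
      using LIMSEQ_D[OF Q.sinc_weight_mass_tendsto, of "e / 6"] e unfolding w_def by auto
    then show ?thesis by (intro that[of "1 / real (Suc k)"]) auto
  qed
  obtain n1 where n1: "\<And>n. n \<ge> n1 \<Longrightarrow> norm (W (Qn n) h u - W Q h u) < e / 6"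
    using LIMSEQ_D[OF W_tendsto[OF h(1), of u], of "e / 6"] e by auto
  obtain n2 where n2: "\<And>n. n \<ge> n2 \<Longrightarrow> norm (W (Qn n) h 0 - W Q h 0) < e / 6"
    using LIMSEQ_D[OF W_tendsto[OF h(1), of 0], of "e / 6"] e by auto
  have "norm (char (Qn n) u - char Q u) < e" if n: "n \<ge> max n1 n2" for n
  proof -
    have a: "norm (char (Qn n) u - W (Qn n) h u) \<le> 1 - w (Qn n) h"
      "norm (char Q u - W Q h u) \<le> 1 - w Q h"
      unfolding W_def w_def by (rule Qn.sinc_weighted_char(3) Q.sinc_weighted_char(3))+
    have b: "\<bar>w (Qn n) h - w Q h\<bar> < e / 6"
      using n2[of n] n unfolding w_W [symmetric] of_real_diff [symmetric] norm_of_real by auto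
    have "char (Qn n) u - char Q u = (char (Qn n) u - W (Qn n) h u) + (W (Qn n) h u - W Q h u)
        - (char Q u - W Q h u)" by simp
    also have "norm \<dots> \<le> norm (char (Qn n) u - W (Qn n) h u) + norm (W (Qn n) h u - W Q h u)
        + norm (char Q u - W Q h u)"
      by (rule order_trans[OF norm_triangle_ineq4]) (intro add_right_mono norm_triangle_ineq)
    also have "\<dots> < e"
    proof -
      have "norm (W (Qn n) h u - W Q h u) < e / 6" using n1[of n] n by simp
      then show ?thesis using a b h(2) e by argo
    qed
    finally show ?thesis .
  qed
  then show "\<exists>no. \<forall>n\<ge>no. norm (char (Qn n) u - char Q u) < e" by blast
qed

text \<open>The quotient is a continuous map from the connected line to the finite set of \<open>n\<close>-th roots
  of unity, hence constant.\<close>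

lemma continuous_nth_root_unique:
  fixes f g :: "real \<Rightarrow> complex"
  assumes f: "continuous_on UNIV f" and g: "continuous_on UNIV g"
    and pow: "\<And>u. f u ^ n = g u ^ n" and nz: "\<And>u. g u \<noteq> 0"
    and "f 0 = g 0" "1 \<le> n"
  shows "f u = g u"
proof -
  have "(\<lambda>u. f u / g u) ` UNIV \<subseteq> {z. z ^ n = 1}"
    using pow nz by (auto simp: power_divide)
  then have "finite ((\<lambda>u. f u / g u) ` UNIV)"
    using finite_roots_unity[OF \<open>1 \<le> n\<close>] by (rule finite_subset)
  then have "(\<lambda>u. f u / g u) constant_on UNIV"
    using f g nz by (intro continuous_finite_range_constant continuous_on_divide) auto
  then have "f u / g u = f 0 / g 0" by (auto simp: constant_on_def)
  then show ?thesis using assms by (auto simp: divide_eq_eq)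
qed

lemma has_vector_derivative_at_0_quadratic:
  fixes f :: "real \<Rightarrow> 'a::real_normed_vector"
  assumes "\<And>u. norm (f u - f 0 - u *\<^sub>R c) \<le> C * u\<^sup>2"
  shows "(f has_vector_derivative c) (at 0)"
proof -
  have "((\<lambda>h. norm (f (0 + h) - f 0 - h *\<^sub>R c) / norm h) \<longlongrightarrow> 0) (at 0)"
  proof (rule tendsto_sandwich[of "\<lambda>_. 0" _ _ "\<lambda>h. C * \<bar>h\<bar>"])
    show "((\<lambda>h::real. C * \<bar>h\<bar>) \<longlongrightarrow> 0) (at 0)"
      by (intro tendsto_mult_right_zero tendsto_rabs_zero tendsto_ident_at)
    show "\<forall>\<^sub>F h in at 0. norm (f (0 + h) - f 0 - h *\<^sub>R c) / norm h \<le> C * \<bar>h\<bar>"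
    proof (intro always_eventually allI)
      fix h :: real
      have "norm (f (0 + h) - f 0 - h *\<^sub>R c) / norm h \<le> C * h\<^sup>2 / norm h"
        using assms[of h] by (intro divide_right_mono) auto
      then show "norm (f (0 + h) - f 0 - h *\<^sub>R c) / norm h \<le> C * \<bar>h\<bar>"
        by (cases "h = 0") (auto simp: power2_eq_square abs_if)
    qed
  qed auto
  then show ?thesis
    unfolding has_vector_derivative_def has_derivative_at by (simp add: bounded_linear_scaleR_left)
qed

lemma (in real_distribution) char_minus_1_eq:
  assumes int: "integrable M (\<lambda>x. x)" and mean: "integral\<^sup>L M (\<lambda>x. x) = 0"
  shows "char M u - 1 = (CLINT x|M. iexp (u * x) - 1 - \<i> * complex_of_real (u * x))"
proof -
  have e: "integrable M (\<lambda>x. iexp (u * x))" by (rule integrable_iexp) simp_all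
  have "(CLINT x|M. iexp (u * x) - 1 - \<i> * complex_of_real (u * x)) =
      (CLINT x|M. iexp (u * x)) - (CLINT x|M. 1) - (CLINT x|M. \<i> * complex_of_real (u * x))"
    using e int by (subst Bochner_Integration.integral_diff; simp)+
  also have "(CLINT x|M. \<i> * complex_of_real (u * x)) = \<i> * complex_of_real (LINT x|M. u * x)"
    by (simp only: integral_mult_right_zero integral_complex_of_real)
  finally show ?thesis using mean prob_space by (simp add: char_def)
qed

text \<open>The derivative of the characteristic function at 0 is 0, because the mean vanishes, and it is
  \<open>\<i> m\<close>, because \<open>\<psi>\<close> is quadratic near 0.\<close>

lemma (in real_distribution) centered_drift_eq_0:
  assumes sq: "integrable M (\<lambda>x. x\<^sup>2)" and mean: "integral\<^sup>L M (\<lambda>x. x) = 0"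
    and char: "\<And>u. char M u = exp (\<i> * complex_of_real (m * u) + \<psi> u)"
    and \<psi>: "\<And>u. norm (\<psi> u) \<le> C * u\<^sup>2"
  shows "m = 0"
proof -
  have int: "integrable M (\<lambda>x. x)"
    using square_integrable_imp_integrable[of "\<lambda>x. x"] sq by simp
  have \<psi>0: "\<psi> 0 = 0" using \<psi>[of 0] by simp
  have "norm (char M u - char M 0 - u *\<^sub>R 0) \<le> (integral\<^sup>L M (\<lambda>x. x\<^sup>2) / 2) * u\<^sup>2" for u
  proof -
    let ?f = "\<lambda>x. iexp (u * x) - 1 - \<i> * complex_of_real (u * x)"
    have "norm (char M u - 1) \<le> (LINT x|M. norm (?f x))"
      unfolding char_minus_1_eq[OF int mean] by (rule integral_norm_bound)
    also have "\<dots> \<le> (LINT x|M. (u * x)\<^sup>2 / 2)"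
    proof (rule integral_mono)
      have "integrable M (\<lambda>x. iexp (u * x))" by (rule integrable_iexp) simp_all
      moreover have "integrable M (\<lambda>x. \<i> * complex_of_real (u * x))"
        using int by (intro integrable_mult_right integrable_of_real) simp
      ultimately show "integrable M (\<lambda>x. norm (?f x))"
        by (intro integrable_norm Bochner_Integration.integrable_diff) simp_all
      show "integrable M (\<lambda>x. (u * x)\<^sup>2 / 2)" using sq by (simp add: power_mult_distrib)
    qed (rule norm_iexp_remainder_le)
    finally show ?thesis by (simp add: power_mult_distrib char_zero mult.commute)
  qed
  then have 1: "(char M has_vector_derivative 0) (at 0)"
    by (rule has_vector_derivative_at_0_quadratic)
  let ?w = "\<lambda>u. \<i> * complex_of_real (m * u) + \<psi> u"
  have "(?w has_vector_derivative (\<i> * complex_of_real m)) (at 0)"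
  proof (rule has_vector_derivative_at_0_quadratic)
    fix u
    have "?w u - ?w 0 - u *\<^sub>R (\<i> * complex_of_real m) = \<psi> u"
      by (simp add: \<psi>0 scaleR_conv_of_real)
    then show "norm (?w u - ?w 0 - u *\<^sub>R (\<i> * complex_of_real m)) \<le> C * u\<^sup>2"
      using \<psi>[of u] by (simp only:)
  qed
  then have "((exp \<circ> ?w) has_vector_derivative (\<i> * complex_of_real m) * exp (?w 0)) (at 0)"
    by (rule field_vector_diff_chain_at) (rule DERIV_exp)
  moreover have "exp \<circ> ?w = char M" using char by auto
  ultimately have "(char M has_vector_derivative (\<i> * complex_of_real m)) (at 0)"
    by (simp add: \<psi>0)
  then have "\<i> * complex_of_real m = 0"
    using 1 by (rule vector_derivative_unique_at)
  then show ?thesis by simp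
qed

text \<open>For splitting integrals against a measure that is described by its values on sets.\<close>

lemma
  fixes f :: "'a \<Rightarrow> 'b::{banach, second_countable_topology}"
  assumes f: "integrable C f"
    and sets: "sets D = sets C" "sets E = sets C"
    and add: "\<And>A. A \<in> sets C \<Longrightarrow> emeasure C A = emeasure D A + emeasure E A"
  shows integrable_of_measure_sum: "integrable D f" "integrable E f"
    and integral_measure_sum: "integral\<^sup>L C f = integral\<^sup>L D f + integral\<^sup>L E f"
proof -
  have space: "space D = space C" "space E = space C"
    using sets by (auto dest: sets_eq_imp_space_eq)
  have mono: "integrable D g" "integrable E g" if "integrable C g" for g :: "'a \<Rightarrow> 'b"
  proof -
    have le: "D \<le> C" "E \<le> C"
      using sets add by (simp_all add: le_measure)
    have "integrable F g" if F: "F \<le> C" "sets F = sets C" for F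
    proof (rule integrableI_bounded)
      show "g \<in> borel_measurable F"
        using \<open>integrable C g\<close> F by (simp add: measurable_cong_sets[OF F(2) refl])
      have "(\<integral>\<^sup>+x. norm (g x) \<partial>F) \<le> (\<integral>\<^sup>+x. norm (g x) \<partial>C)"
        using F by (intro nn_integral_mono_measure)
      also have "\<dots> < \<infinity>" using \<open>integrable C g\<close> by (simp add: integrable_iff_bounded)
      finally show "(\<integral>\<^sup>+x. norm (g x) \<partial>F) < \<infinity>" .
    qed
    then show "integrable D g" "integrable E g" using le sets by auto
  qed
  then show "integrable D f" "integrable E f" using f by auto
  from f show "integral\<^sup>L C f = integral\<^sup>L D f + integral\<^sup>L E f"
  proof (induction rule: integrable_induct)
    case (base A c)
    then have "emeasure D A < \<infinity>" "emeasure E A < \<infinity>"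
      using add[of A] by (auto simp: less_top)
    then have "measure C A = measure D A + measure E A"
      using add[OF base(1)] base unfolding measure_def by (simp add: enn2real_plus)
    moreover have "integral\<^sup>L F (\<lambda>x. indicator A x *\<^sub>R c) = measure F A *\<^sub>R c"
      if "sets F = sets C" "emeasure F A < \<infinity>" for F
      using that base(1) sets.Int_space_eq2[of A F] by simp
    ultimately show ?case
      using base sets \<open>emeasure D A < \<infinity>\<close> \<open>emeasure E A < \<infinity>\<close> by (simp only: scaleR_add_left)
  next
    case (add f g)
    then show ?case using mono[of f] mono[of g] by simp
  next
    case (lim f s)
    have meas: "f \<in> borel_measurable C" "\<And>i. s i \<in> borel_measurable C"
      using lim by auto
    have IH: "integral\<^sup>L C (s i) = integral\<^sup>L D (s i) + integral\<^sup>L E (s i)" for i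
      by (rule lim)
    have conv: "(\<lambda>i. integral\<^sup>L F (s i)) \<longlonglongrightarrow> integral\<^sup>L F f"
      if F: "space F = space C" "sets F = sets C" "integrable F f" for F
      using meas lim F measurable_cong_sets[OF F(2) refl]
      by (intro integral_dominated_convergence[where w = "\<lambda>x. 2 * norm (f x)"]) auto
    have "(\<lambda>i. integral\<^sup>L C (s i)) \<longlonglongrightarrow> integral\<^sup>L D f + integral\<^sup>L E f"
      unfolding IH using sets space mono[OF \<open>integrable C f\<close>] by (intro tendsto_add conv)
    then show ?case using conv[of C] lim by (intro LIMSEQ_unique[of _ "integral\<^sup>L C f"]) auto
  qed
qed

section \<open>Convolution roots of a centered infinitely divisible law\<close>

text \<open>Taking logarithms, \<open>ln (1 + y)\<close> differs from \<open>y\<close> by at most \<open>2 y\<^sup>2\<close>, and here \<open>y = w n / (n + 1)\<close>.\<close>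

lemma tendsto_one_plus_div_power:
  fixes w :: "nat \<Rightarrow> real"
  assumes w: "w \<longlonglongrightarrow> l"
  shows "(\<lambda>n. (1 + w n / real (Suc n)) ^ Suc n) \<longlonglongrightarrow> exp l"
proof -
  let ?y = "\<lambda>n. w n / real (Suc n)"
  have inv: "(\<lambda>n. 1 / real (Suc n)) \<longlonglongrightarrow> 0"
    using LIMSEQ_inverse_real_of_nat by (simp add: inverse_eq_divide)
  have y0: "?y \<longlonglongrightarrow> 0"
    using tendsto_mult[OF w inv] by simp
  have small: "eventually (\<lambda>n. \<bar>?y n\<bar> < 1 / 2) sequentially"
    using tendsto_rabs_zero[OF y0] by (rule order_tendstoD) simp
  have "(\<lambda>n. real (Suc n) * (ln (1 + ?y n) - ?y n)) \<longlonglongrightarrow> 0"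
  proof (rule Lim_null_comparison)
    show "(\<lambda>n. 2 * (w n * ?y n)) \<longlonglongrightarrow> 0"
      using tendsto_mult[OF tendsto_const tendsto_mult[OF w y0], of 2] by simp
    show "\<forall>\<^sub>F n in sequentially. norm (real (Suc n) * (ln (1 + ?y n) - ?y n)) \<le> 2 * (w n * ?y n)"
      using small
    proof eventually_elim
      case (elim n)
      have "norm (real (Suc n) * (ln (1 + ?y n) - ?y n)) = real (Suc n) * \<bar>ln (1 + ?y n) - ?y n\<bar>"
        by (simp add: abs_mult)
      also have "\<dots> \<le> real (Suc n) * (2 * (?y n)\<^sup>2)"
        using elim by (intro mult_left_mono abs_ln_one_plus_x_minus_x_bound) auto
      also have "\<dots> = 2 * (w n * ?y n)"
        by (simp add: power2_eq_square)
      finally show ?case .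
    qed
  qed
  from tendsto_add[OF this w] have "(\<lambda>n. real (Suc n) * ln (1 + ?y n)) \<longlonglongrightarrow> l"
    by (simp add: right_diff_distrib)
  then have "(\<lambda>n. exp (real (Suc n) * ln (1 + ?y n))) \<longlonglongrightarrow> exp l"
    by (rule tendsto_exp)
  moreover have "eventually (\<lambda>n. exp (real (Suc n) * ln (1 + ?y n)) = (1 + ?y n) ^ Suc n) sequentially"
    using small
  proof eventually_elim
    case (elim n)
    then have "0 < 1 + ?y n" by linarith
    then show ?case by (simp only: exp_of_nat_mult exp_ln)
  qed
  ultimately show ?thesis by (rule Lim_transform_eventually)
qed

lemma tendsto_exp_div_minus_1:
  fixes z :: complex
  shows "(\<lambda>n. of_nat (Suc n) * (exp (z / of_nat (Suc n)) - 1)) \<longlonglongrightarrow> z"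
proof (cases "z = 0")
  case False
  have "(\<lambda>n. z * inverse (of_nat (Suc n))) \<longlonglongrightarrow> z * 0"
    by (intro tendsto_mult tendsto_const LIMSEQ_Suc[OF lim_inverse_n])
  then have "filterlim (\<lambda>n. z / of_nat (Suc n)) (at 0) sequentially"
    using False by (simp add: filterlim_at divide_inverse del: of_nat_Suc)
  moreover have "((\<lambda>h::complex. (exp (0 + h) - exp 0) / h) \<longlongrightarrow> exp 0) (at 0)"
    using DERIV_exp[of 0] by (simp only: DERIV_def)
  ultimately have "(\<lambda>n. (exp (0 + z / of_nat (Suc n)) - exp 0) / (z / of_nat (Suc n))) \<longlonglongrightarrow> exp 0"
    by (rule filterlim_compose[rotated])
  from tendsto_mult[OF tendsto_const this, of z] show ?thesis
    using False by (simp add: mult.commute del: of_nat_Suc)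
qed simp

text \<open>The hypothesis on \<open>Q\<close> is the Levy-Khintchine formula in its finite variance form: \<open>V Q\<close> is the
  measure \<open>a \<delta>\<^sub>0(dx) + x\<^sup>2 \<nu>(dx)\<close>, and there is no drift.\<close>

locale centered_id_law = real_distribution \<mu> for \<mu> :: "real measure" +
  fixes Q :: "real measure" and V :: real
  assumes inf_div: "infinitely_divisible \<mu>"
    and integrable_square: "integrable \<mu> (\<lambda>x. x\<^sup>2)"
    and mean_0: "integral\<^sup>L \<mu> (\<lambda>x. x) = 0"
    and second_moment: "integral\<^sup>L \<mu> (\<lambda>x. x\<^sup>2) = V"
    and V_pos: "0 < V"
    and Q: "real_distribution Q"
    and char_eq: "\<And>u. char \<mu> u = exp (complex_of_real V * integral\<^sup>L Q (levy_kernel u))"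
begin

sublocale Q: real_distribution Q by (rule Q)

text \<open>The convolution roots are indexed from 0: the law has \<open>n + 1\<close> summands with law \<open>conv_root n\<close>.\<close>

definition conv_root :: "nat \<Rightarrow> real measure" where
  "conv_root n = (SOME \<rho>. real_distribution \<rho> \<and>
     \<mu> = distr (Pi\<^sub>M {..<Suc n} (\<lambda>_. \<rho>)) borel (\<lambda>x. \<Sum>i<Suc n. x i))"

lemma
  shows real_distribution_conv_root: "real_distribution (conv_root n)"
    and distr_conv_root: "\<mu> = distr (Pi\<^sub>M {..<Suc n} (\<lambda>_. conv_root n)) borel (\<lambda>x. \<Sum>i<Suc n. x i)"
proof -
  have "\<exists>\<rho>. real_distribution \<rho> \<and>
      \<mu> = distr (Pi\<^sub>M {..<Suc n} (\<lambda>_. \<rho>)) borel (\<lambda>x. \<Sum>i<Suc n. x i)"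
    using inf_div unfolding infinitely_divisible_def by (metis le_add1 plus_1_eq_Suc)
  then have "real_distribution (conv_root n) \<and>
      \<mu> = distr (Pi\<^sub>M {..<Suc n} (\<lambda>_. conv_root n)) borel (\<lambda>x. \<Sum>i<Suc n. x i)"
    unfolding conv_root_def by (rule someI_ex)
  then show "real_distribution (conv_root n)"
    "\<mu> = distr (Pi\<^sub>M {..<Suc n} (\<lambda>_. conv_root n)) borel (\<lambda>x. \<Sum>i<Suc n. x i)" by auto
qed

lemma iid_conv_root: "iid_copies (conv_root n) (Suc n)"
  using real_distribution_conv_root by (simp add: iid_copies_def iid_copies_axioms_def)

lemma
  shows integrable_square_conv_root: "integrable (conv_root n) (\<lambda>x. x\<^sup>2)"
    and integrable_conv_root: "integrable (conv_root n) (\<lambda>x. x)"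
    and mean_conv_root: "integral\<^sup>L (conv_root n) (\<lambda>x. x) = 0"
    and second_moment_conv_root: "integral\<^sup>L (conv_root n) (\<lambda>x. x\<^sup>2) = V / real (Suc n)"
proof -
  interpret R: iid_copies "conv_root n" "Suc n" by (rule iid_conv_root)
  have meas: "(\<lambda>x. \<Sum>i<Suc n. x i) \<in> borel_measurable R.P"
    by (intro borel_measurable_sum R.measurable_coord) simp
  have "integrable R.P (\<lambda>x. (\<Sum>i<Suc n. x i)\<^sup>2)"
    using integrable_square
    by (subst (asm) distr_conv_root[of n])
      (simp only: integrable_distr_eq[OF meas] borel_measurable_power measurable_ident_sets)
  then show sq: "integrable (conv_root n) (\<lambda>x. x\<^sup>2)"
    by (rule R.integrable_square_of_sum)
  then show int: "integrable (conv_root n) (\<lambda>x. x)"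
    using R.square_integrable_imp_integrable[of "\<lambda>x. x"] by simp
  have "integral\<^sup>L \<mu> (\<lambda>x. x) = integral\<^sup>L R.P (\<lambda>x. \<Sum>i<Suc n. x i)"
    by (subst distr_conv_root[of n]) (rule integral_distr[OF meas], simp)
  then show mean: "integral\<^sup>L (conv_root n) (\<lambda>x. x) = 0"
    using R.expectation_sum[OF int] mean_0 by simp
  have "integral\<^sup>L \<mu> (\<lambda>x. x\<^sup>2) = integral\<^sup>L R.P (\<lambda>x. (\<Sum>i<Suc n. x i)\<^sup>2)"
    by (subst distr_conv_root[of n]) (rule integral_distr[OF meas], simp)
  then show "integral\<^sup>L (conv_root n) (\<lambda>x. x\<^sup>2) = V / real (Suc n)"
    using R.expectation_square_sum[OF sq mean] second_moment by (simp add: field_simps)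
qed

text \<open>The root reweighted by the square of the jump. It is a probability measure since a single
  summand has second moment \<open>V / (n + 1)\<close>.\<close>

definition biased_root :: "nat \<Rightarrow> real measure" where
  "biased_root n = density (conv_root n) (\<lambda>x. ennreal (real (Suc n) / V * x\<^sup>2))"

lemma integral_biased_root:
  fixes f :: "real \<Rightarrow> 'b::{banach, second_countable_topology}"
  assumes "f \<in> borel_measurable borel"
  shows "integral\<^sup>L (biased_root n) f = (real (Suc n) / V) *\<^sub>R (\<integral>x. x\<^sup>2 *\<^sub>R f x \<partial>conv_root n)"
proof -
  interpret R: real_distribution "conv_root n" by (rule real_distribution_conv_root)
  have "integral\<^sup>L (biased_root n) f = (\<integral>x. (real (Suc n) / V * x\<^sup>2) *\<^sub>R f x \<partial>conv_root n)"
    unfolding biased_root_def using assms V_pos by (intro integral_density) auto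
  also have "\<dots> = (\<integral>x. (real (Suc n) / V) *\<^sub>R (x\<^sup>2 *\<^sub>R f x) \<partial>conv_root n)" by simp
  also have "\<dots> = (real (Suc n) / V) *\<^sub>R (\<integral>x. x\<^sup>2 *\<^sub>R f x \<partial>conv_root n)" by (rule integral_scaleR_right)
  finally show ?thesis .
qed

lemma real_distribution_biased_root: "real_distribution (biased_root n)"
proof -
  interpret R: real_distribution "conv_root n" by (rule real_distribution_conv_root)
  have "emeasure (biased_root n) (space (biased_root n)) = (\<integral>\<^sup>+x. ennreal (real (Suc n) / V * x\<^sup>2) \<partial>conv_root n)"
    by (simp add: biased_root_def emeasure_density)
  also have "\<dots> = ennreal (integral\<^sup>L (conv_root n) (\<lambda>x. real (Suc n) / V * x\<^sup>2))"
    using integrable_square_conv_root V_pos by (intro nn_integral_eq_integral integrable_mult_right AE_I2) auto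
  also have "\<dots> = 1"
    using V_pos by (simp only: integral_mult_right_zero second_moment_conv_root) simp
  finally have "prob_space (biased_root n)" by (rule prob_spaceI)
  then show ?thesis
    by (simp add: real_distribution_def real_distribution_axioms_def biased_root_def)
qed

lemma continuous_levy_exponent: "continuous_on UNIV (\<lambda>u. integral\<^sup>L Q (levy_kernel u))"
proof (rule continuous_at_imp_continuous_on, rule ballI)
  fix u :: real
  show "isCont (\<lambda>u. integral\<^sup>L Q (levy_kernel u)) u"
    unfolding continuous_at_sequentially
  proof (intro allI impI)
    fix s :: "nat \<Rightarrow> real"
    assume s: "s \<longlonglongrightarrow> u"
    then obtain B where B: "\<And>n. norm (s n) \<le> B"
      using convergent_imp_Bseq[of s] by (auto simp: convergent_def Bseq_def)
    have "(\<lambda>n. integral\<^sup>L Q (levy_kernel (s n))) \<longlonglongrightarrow> integral\<^sup>L Q (levy_kernel u)"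
    proof (rule integral_dominated_convergence[where w = "\<lambda>_. B\<^sup>2 / 2"])
      show "AE x in Q. (\<lambda>n. levy_kernel (s n) x) \<longlonglongrightarrow> levy_kernel u x"
        by (intro AE_I2 isCont_tendsto_compose[OF isCont_levy_kernel_param s])
      show "AE x in Q. norm (levy_kernel (s n) x) \<le> B\<^sup>2 / 2" for n
      proof (rule AE_I2)
        fix x
        have "(s n)\<^sup>2 \<le> B\<^sup>2" using power_mono[OF B[of n], of 2] by simp
        then show "norm (levy_kernel (s n) x) \<le> B\<^sup>2 / 2"
          using norm_levy_kernel_le[of "s n" x] by linarith
      qed
    qed simp_all
    then show "((\<lambda>u. integral\<^sup>L Q (levy_kernel u)) \<circ> s) \<longlonglongrightarrow> integral\<^sup>L Q (levy_kernel u)"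
      by (simp add: comp_def)
  qed
qed

text \<open>Both sides are continuous, agree at 0 and have the same power; this selects the right branch of
  the root for every \<open>u\<close>, not just for \<open>u\<close> near 0.\<close>

lemma char_conv_root:
  "char (conv_root n) u = exp (complex_of_real V * integral\<^sup>L Q (levy_kernel u) / of_nat (Suc n))"
proof (rule continuous_nth_root_unique[where n = "Suc n"])
  interpret R: iid_copies "conv_root n" "Suc n" by (rule iid_conv_root)
  show "continuous_on UNIV (char (conv_root n))"
    by (intro continuous_at_imp_continuous_on ballI R.isCont_char)
  show "continuous_on UNIV (\<lambda>u. exp (complex_of_real V * integral\<^sup>L Q (levy_kernel u) / of_nat (Suc n)))"
    by (intro continuous_intros continuous_levy_exponent) (simp del: of_nat_Suc)
  show "char (conv_root n) u ^ Suc n =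
      exp (complex_of_real V * integral\<^sup>L Q (levy_kernel u) / of_nat (Suc n)) ^ Suc n" for u
    using R.char_sum[of u] char_eq[of u]
    by (simp only: distr_conv_root[of n, symmetric] exp_of_nat_mult [symmetric])
      (simp del: of_nat_Suc power_Suc)
  have "levy_kernel 0 = (\<lambda>_. 0)"
    using norm_levy_kernel_le[of 0] by (intro ext) simp
  then show "char (conv_root n) 0 = exp (complex_of_real V * integral\<^sup>L Q (levy_kernel 0) / of_nat (Suc n))"
    by (simp add: R.char_zero)
qed simp_all

text \<open>By centering, the left-hand side is \<open>(n + 1) (\<phi> - 1) / V\<close>, where \<open>\<phi> = exp (\<psi> / (n + 1))\<close> is
  the characteristic function of the root.\<close>

lemma levy_kernel_biased_root_tendsto:
  "(\<lambda>n. integral\<^sup>L (biased_root n) (levy_kernel u)) \<longlonglongrightarrow> integral\<^sup>L Q (levy_kernel u)"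
proof -
  define \<psi> where "\<psi> = complex_of_real V * integral\<^sup>L Q (levy_kernel u)"
  have "integral\<^sup>L (biased_root n) (levy_kernel u) =
      of_nat (Suc n) * (exp (\<psi> / of_nat (Suc n)) - 1) / complex_of_real V" for n
  proof -
    interpret R: real_distribution "conv_root n" by (rule real_distribution_conv_root)
    have "(CLINT x|conv_root n. x\<^sup>2 *\<^sub>R levy_kernel u x) = char (conv_root n) u - 1"
      unfolding R.char_minus_1_eq[OF integrable_conv_root mean_conv_root] scaleR_conv_of_real
        levy_kernel_mult_square ..
    then show ?thesis
      unfolding integral_biased_root[OF measurable_levy_kernel] char_conv_root \<psi>_def
      by (simp add: scaleR_conv_of_real del: of_nat_Suc)
  qed
  moreover have "(\<lambda>n. of_nat (Suc n) * (exp (\<psi> / of_nat (Suc n)) - 1) / complex_of_real V)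
      \<longlonglongrightarrow> \<psi> / complex_of_real V"
    using V_pos by (intro tendsto_divide tendsto_exp_div_minus_1 tendsto_const) simp
  ultimately show ?thesis using V_pos by (simp add: \<psi>_def)
qed

lemma weak_conv_biased_root: "weak_conv_m biased_root Q"
  by (intro levy_continuity char_tendsto_of_levy_kernel real_distribution_biased_root Q levy_kernel_biased_root_tendsto)

section \<open>The moment generating function\<close>

lemma trunc_kernel_biased_root_tendsto:
  assumes "0 \<le> t" "1 \<le> K"
  shows "(\<lambda>n. integral\<^sup>L (biased_root n) (trunc_kernel t K)) \<longlonglongrightarrow> integral\<^sup>L Q (trunc_kernel t K)"
proof -
  obtain C where C: "\<And>x. norm (trunc_kernel t K x) \<le> C"
    using trunc_kernel_bounded[OF assms] by blast
  show ?thesis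
    using assms
    by (intro weak_conv_imp_integral_bdd_continuous_conv[OF real_distribution_biased_root Q weak_conv_biased_root _ C]
        isCont_trunc_kernel) simp
qed

text \<open>Capping a summand at \<open>K\<close> makes its exponential moment finite; the mean of the summand is 0, so
  the uncapped compensator in the kernel contributes nothing.\<close>

lemma nn_integral_exp_min_conv_root:
  assumes "0 \<le> t" "1 \<le> K"
  shows "0 \<le> 1 + V * integral\<^sup>L (biased_root n) (trunc_kernel t K) / real (Suc n)"
    and "(\<integral>\<^sup>+x. ennreal (exp (t * min x K)) \<partial>conv_root n) =
      ennreal (1 + V * integral\<^sup>L (biased_root n) (trunc_kernel t K) / real (Suc n))"
proof -
  interpret R: real_distribution "conv_root n" by (rule real_distribution_conv_root)
  have int: "integrable (conv_root n) (\<lambda>x. exp (t * min x K))"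
    using assms by (intro R.integrable_const_bound[where B = "exp (t * K)"] AE_I2)
      (auto intro!: mult_left_mono)
  have "V * integral\<^sup>L (biased_root n) (trunc_kernel t K) / real (Suc n) =
      (\<integral>x. x\<^sup>2 * trunc_kernel t K x \<partial>conv_root n)"
    using V_pos by (simp add: integral_biased_root)
  also have "\<dots> = (\<integral>x. exp (t * min x K) - 1 - t * x \<partial>conv_root n)"
    using assms by (simp add: trunc_kernel_mult_square)
  also have "\<dots> = (\<integral>x. exp (t * min x K) \<partial>conv_root n) - 1"
    using int integrable_conv_root[of n] mean_conv_root[of n] R.prob_space
    by (simp add: Bochner_Integration.integral_diff)
  finally have eq: "1 + V * integral\<^sup>L (biased_root n) (trunc_kernel t K) / real (Suc n) =
      (\<integral>x. exp (t * min x K) \<partial>conv_root n)" by simp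
  show "0 \<le> 1 + V * integral\<^sup>L (biased_root n) (trunc_kernel t K) / real (Suc n)"
    unfolding eq by simp
  show "(\<integral>\<^sup>+x. ennreal (exp (t * min x K)) \<partial>conv_root n) =
      ennreal (1 + V * integral\<^sup>L (biased_root n) (trunc_kernel t K) / real (Suc n))"
    unfolding eq using int by (intro nn_integral_eq_integral) auto
qed

text \<open>Capping every summand decreases the sum. The exponential moment of the capped sum is
  \<open>(1 + w\<^sub>n / (n + 1))\<^bsup>n + 1\<^esup>\<close> with convergent \<open>w\<^sub>n\<close>.\<close>

lemma nn_integral_exp_ge:
  assumes "0 \<le> t" "1 \<le> K"
  shows "ennreal (exp (V * integral\<^sup>L Q (trunc_kernel t K))) \<le> (\<integral>\<^sup>+x. ennreal (exp (t * x)) \<partial>\<mu>)"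
proof (rule LIMSEQ_le_const2)
  let ?w = "\<lambda>n. V * integral\<^sup>L (biased_root n) (trunc_kernel t K)"
  show "(\<lambda>n. ennreal ((1 + ?w n / real (Suc n)) ^ Suc n)) \<longlonglongrightarrow>
      ennreal (exp (V * integral\<^sup>L Q (trunc_kernel t K)))"
    by (intro tendsto_ennrealI tendsto_one_plus_div_power tendsto_mult tendsto_const
        trunc_kernel_biased_root_tendsto assms)
  have "ennreal ((1 + ?w n / real (Suc n)) ^ Suc n) \<le> (\<integral>\<^sup>+x. ennreal (exp (t * x)) \<partial>\<mu>)" for n
  proof -
    interpret R: iid_copies "conv_root n" "Suc n" by (rule iid_conv_root)
    have meas: "(\<lambda>x. \<Sum>i<Suc n. x i) \<in> borel_measurable R.P"
      by (intro borel_measurable_sum R.measurable_coord) simp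
    have "ennreal ((1 + ?w n / real (Suc n)) ^ Suc n) =
        (\<integral>\<^sup>+x. ennreal (exp (t * min x K)) \<partial>conv_root n) ^ Suc n"
      using nn_integral_exp_min_conv_root[OF assms, of n] by (simp only: ennreal_power)
    also have "\<dots> \<le> (\<integral>\<^sup>+x. ennreal (exp (t * x)) \<partial>conv_root n) ^ Suc n"
      using assms by (intro power_mono nn_integral_mono ennreal_leI) (auto intro!: mult_left_mono)
    also have "\<dots> = (\<integral>\<^sup>+x. ennreal (exp (\<Sum>i<Suc n. t * x i)) \<partial>R.P)"
      by (rule R.nn_integral_exp_sum [symmetric]) simp
    also have "\<dots> = (\<integral>\<^sup>+x. ennreal (exp (t * (\<Sum>i<Suc n. x i))) \<partial>R.P)"
      by (simp only: sum_distrib_left)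
    also have "\<dots> = (\<integral>\<^sup>+x. ennreal (exp (t * x)) \<partial>\<mu>)"
      by (subst distr_conv_root[of n]) (rule nn_integral_distr[OF meas, symmetric], simp)
    finally show ?thesis .
  qed
  then show "\<exists>N. \<forall>n\<ge>N. ennreal ((1 + ?w n / real (Suc n)) ^ Suc n) \<le> (\<integral>\<^sup>+x. ennreal (exp (t * x)) \<partial>\<mu>)"
    by blast
qed

text \<open>The sum and the capped sum differ only if some summand exceeds \<open>K\<close>, which by Chebyshev's
  inequality and the union bound has probability at most \<open>V / K\<^sup>2\<close>, for every number of summands. On
  this event the integrand is at most \<open>L\<close>; outside it the exponential moment of the capped sum
  is at most \<open>exp w\<^sub>n\<close>, because \<open>1 + y \<le> e\<^sup>y\<close>.\<close>

lemma nn_integral_min_exp_le: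
  assumes "0 \<le> t" "1 \<le> K" "0 \<le> L"
  shows "(\<integral>\<^sup>+x. ennreal (min (exp (t * x)) L) \<partial>\<mu>) \<le>
     ennreal (exp (V * integral\<^sup>L Q (trunc_kernel t K)) + L * (V / K\<^sup>2))"
proof (rule LIMSEQ_le_const)
  let ?w = "\<lambda>n. V * integral\<^sup>L (biased_root n) (trunc_kernel t K)"
  show "(\<lambda>n. ennreal (exp (?w n) + L * (V / K\<^sup>2))) \<longlonglongrightarrow>
      ennreal (exp (V * integral\<^sup>L Q (trunc_kernel t K)) + L * (V / K\<^sup>2))"
    by (intro tendsto_ennrealI tendsto_add tendsto_exp tendsto_mult tendsto_const
        trunc_kernel_biased_root_tendsto assms)
  have "(\<integral>\<^sup>+x. ennreal (min (exp (t * x)) L) \<partial>\<mu>) \<le> ennreal (exp (?w n) + L * (V / K\<^sup>2))" for n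
  proof -
    interpret R: iid_copies "conv_root n" "Suc n" by (rule iid_conv_root)
    have meas: "(\<lambda>x. \<Sum>i<Suc n. x i) \<in> borel_measurable R.P"
      by (intro borel_measurable_sum R.measurable_coord) simp
    have measi: "(\<lambda>x. x i) \<in> borel_measurable R.P" if "i < Suc n" for i
      using that by (rule R.measurable_coord)
    have pt: "ennreal (min (exp (t * (\<Sum>i<Suc n. x i))) L) \<le>
        ennreal (exp (\<Sum>i<Suc n. t * min (x i) K)) + (\<Sum>i<Suc n. ennreal L * indicator {K<..} (x i))"
      for x :: "nat \<Rightarrow> real"
    proof (cases "\<exists>i<Suc n. K < x i")
      case True
      then obtain i where i: "i < Suc n" "K < x i" by blast
      have "ennreal (min (exp (t * (\<Sum>i<Suc n. x i))) L) \<le> ennreal L * indicator {K<..} (x i)"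
        using i by (simp add: ennreal_leI)
      also have "\<dots> \<le> (\<Sum>i<Suc n. ennreal L * indicator {K<..} (x i))"
        using i by (intro member_le_sum) auto
      finally show ?thesis by (rule add_increasing[OF zero_le])
    next
      case False
      then have "x i \<le> K" if "i < Suc n" for i using that by (meson not_less)
      then have "(\<Sum>i<Suc n. t * min (x i) K) = t * (\<Sum>i<Suc n. x i)"
        unfolding sum_distrib_left by (intro sum.cong) (simp_all add: min_absorb1 del: sum.lessThan_Suc)
      then show ?thesis by (intro add_increasing2) (auto intro!: ennreal_leI)
    qed
    have tail: "(\<integral>\<^sup>+x. ennreal L * indicator {K<..} x \<partial>conv_root n) \<le> ennreal (L * (V / real (Suc n) / K\<^sup>2))"
    proof -
      have "(\<integral>\<^sup>+x. ennreal L * indicator {K<..} x \<partial>conv_root n) \<le> (\<integral>\<^sup>+x. ennreal (L / K\<^sup>2 * x\<^sup>2) \<partial>conv_root n)"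
      proof (rule nn_integral_mono)
        fix x
        have "L \<le> L / K\<^sup>2 * x\<^sup>2" if "K < x"
          using that assms mult_left_mono[of "K\<^sup>2" "x\<^sup>2" L] power_mono[of K x 2] by (simp add: field_simps)
        then show "ennreal L * indicator {K<..} x \<le> ennreal (L / K\<^sup>2 * x\<^sup>2)"
          by (auto simp: indicator_def ennreal_leI)
      qed
      also have "\<dots> = ennreal (\<integral>x. L / K\<^sup>2 * x\<^sup>2 \<partial>conv_root n)"
        using integrable_square_conv_root assms by (intro nn_integral_eq_integral integrable_mult_right AE_I2) auto
      also have "(\<integral>x. L / K\<^sup>2 * x\<^sup>2 \<partial>conv_root n) = L * (V / real (Suc n) / K\<^sup>2)"
        by (simp only: integral_mult_right_zero second_moment_conv_root) simp
      finally show ?thesis .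
    qed
    have "(\<integral>\<^sup>+x. ennreal (min (exp (t * x)) L) \<partial>\<mu>) =
        (\<integral>\<^sup>+x. ennreal (min (exp (t * (\<Sum>i<Suc n. x i))) L) \<partial>R.P)"
      by (subst distr_conv_root[of n]) (rule nn_integral_distr[OF meas], simp)
    also have "\<dots> \<le> (\<integral>\<^sup>+x. ennreal (exp (\<Sum>i<Suc n. t * min (x i) K)) +
        (\<Sum>i<Suc n. ennreal L * indicator {K<..} (x i)) \<partial>R.P)"
      by (intro nn_integral_mono pt)
    also have "\<dots> = (\<integral>\<^sup>+x. ennreal (exp (\<Sum>i<Suc n. t * min (x i) K)) \<partial>R.P) +
        (\<integral>\<^sup>+x. (\<Sum>i<Suc n. ennreal L * indicator {K<..} (x i)) \<partial>R.P)"
      using measi by (intro nn_integral_add) (auto intro!: borel_measurable_sum)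
    also have "(\<integral>\<^sup>+x. ennreal (exp (\<Sum>i<Suc n. t * min (x i) K)) \<partial>R.P) =
        ennreal (1 + ?w n / real (Suc n)) ^ Suc n"
      by (subst R.nn_integral_exp_sum) (simp_all only: nn_integral_exp_min_conv_root(2)[OF assms(1,2)], simp)
    also have "(\<integral>\<^sup>+x. (\<Sum>i<Suc n. ennreal L * indicator {K<..} (x i)) \<partial>R.P) =
        (\<Sum>i<Suc n. \<integral>\<^sup>+x. ennreal L * indicator {K<..} (x i) \<partial>R.P)"
      using measi by (intro nn_integral_sum) auto
    also have "\<dots> = (\<Sum>i<Suc n. \<integral>\<^sup>+x. ennreal L * indicator {K<..} x \<partial>conv_root n)"
      by (intro sum.cong refl R.nn_integral_coord) auto
    also have "\<dots> \<le> (\<Sum>i<Suc n. ennreal (L * (V / real (Suc n) / K\<^sup>2)))"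
      by (intro sum_mono tail)
    also have "\<dots> = ennreal (\<Sum>i<Suc n. L * (V / real (Suc n) / K\<^sup>2))"
      using assms V_pos by (intro sum_ennreal) auto
    also have "(\<Sum>i<Suc n. L * (V / real (Suc n) / K\<^sup>2)) = L * (V / K\<^sup>2)"
      by (simp del: sum.lessThan_Suc)
    also have "ennreal (1 + ?w n / real (Suc n)) ^ Suc n \<le> ennreal (exp (?w n))"
    proof -
      have "(1 + ?w n / real (Suc n)) ^ Suc n \<le> exp (?w n / real (Suc n)) ^ Suc n"
        using nn_integral_exp_min_conv_root(1)[OF assms(1,2)] by (intro power_mono exp_ge_add_one_self)
      also have "\<dots> = exp (real (Suc n) * (?w n / real (Suc n)))"
        by (rule exp_of_nat_mult [symmetric])
      also have "\<dots> = exp (?w n)" by simp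
      finally show ?thesis
        using nn_integral_exp_min_conv_root(1)[OF assms(1,2)] by (simp only: ennreal_power ennreal_leI)
    qed
    finally show ?thesis
      using assms V_pos by (simp add: ennreal_plus add_right_mono)
  qed
  then show "\<exists>N. \<forall>n\<ge>N. (\<integral>\<^sup>+x. ennreal (min (exp (t * x)) L) \<partial>\<mu>) \<le> ennreal (exp (?w n) + L * (V / K\<^sup>2))"
    by blast
qed

end

text \<open>Fatou's lemma in the form in which the caps are removed.\<close>

lemma nn_integral_le_of_tendsto:
  fixes f :: "nat \<Rightarrow> 'a \<Rightarrow> ennreal" and c :: "nat \<Rightarrow> ennreal"
  assumes meas: "\<And>k. f k \<in> borel_measurable M"
    and lim: "\<And>x. x \<in> space M \<Longrightarrow> (\<lambda>k. f k x) \<longlonglongrightarrow> F x"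
    and le: "\<And>k. (\<integral>\<^sup>+x. f k x \<partial>M) \<le> c k"
    and c: "c \<longlonglongrightarrow> C"
  shows "(\<integral>\<^sup>+x. F x \<partial>M) \<le> C"
proof -
  have "(\<integral>\<^sup>+x. F x \<partial>M) = (\<integral>\<^sup>+x. liminf (\<lambda>k. f k x) \<partial>M)"
    by (intro nn_integral_cong lim_imp_Liminf[symmetric] lim) simp_all
  also have "\<dots> \<le> liminf (\<lambda>k. \<integral>\<^sup>+x. f k x \<partial>M)"
    by (intro nn_integral_liminf meas)
  also have "\<dots> \<le> liminf c"
    by (intro Liminf_mono always_eventually allI le)
  also have "liminf c = C"
    using c by (intro lim_imp_Liminf) simp_all
  finally show ?thesis .
qed

context centered_id_law
begin

lemma integrable_trunc_kernel:
  assumes "0 \<le> t" "1 \<le> K"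
  shows "integrable Q (trunc_kernel t K)"
proof -
  obtain C where "\<And>x. norm (trunc_kernel t K x) \<le> C"
    using trunc_kernel_bounded[OF assms] by blast
  then show ?thesis by (intro Q.integrable_const_bound[where B = C] AE_I2) simp_all
qed

text \<open>Removing the cap from the lower bound: the integrals of the capped kernels are bounded by
  \<open>ln m / V\<close>, where \<open>m\<close> is the exponential moment, and Fatou's lemma passes this bound on to the
  limit. This is how an exponential moment of the law controls the large jumps.\<close>

lemma nn_integral_exp_finite_imp:
  assumes t: "0 \<le> t" and fin: "(\<integral>\<^sup>+x. ennreal (exp (t * x)) \<partial>\<mu>) < \<infinity>"
  shows "(\<integral>\<^sup>+x. ennreal (t\<^sup>2 * exp_kernel (t * x)) \<partial>Q) < \<infinity>"
    and "ennreal (exp (V * enn2real (\<integral>\<^sup>+x. ennreal (t\<^sup>2 * exp_kernel (t * x)) \<partial>Q))) \<le>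
      (\<integral>\<^sup>+x. ennreal (exp (t * x)) \<partial>\<mu>)"
proof -
  define m where "m = enn2real (\<integral>\<^sup>+x. ennreal (exp (t * x)) \<partial>\<mu>)"
  have m: "(\<integral>\<^sup>+x. ennreal (exp (t * x)) \<partial>\<mu>) = ennreal m"
    using fin by (simp add: m_def)
  have le_m: "exp (V * integral\<^sup>L Q (trunc_kernel t (real (Suc k)))) \<le> m" for k
    using nn_integral_exp_ge[OF t, of "real (Suc k)"] unfolding m
    by (simp add: m_def ennreal_le_iff2 del: of_nat_Suc)
  then have m_pos: "0 < m" by (rule less_le_trans[OF exp_gt_zero])
  define c where "c = ln m / V"
  have le_c: "integral\<^sup>L Q (trunc_kernel t (real (Suc k))) \<le> c" for k
  proof -
    have "V * integral\<^sup>L Q (trunc_kernel t (real (Suc k))) \<le> ln m"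
      using le_m[of k] m_pos by (simp only: ln_ge_iff)
    then show ?thesis using V_pos by (simp add: c_def field_simps del: of_nat_Suc)
  qed
  \<comment> \<open>The shift by \<open>t / K\<close> makes the kernels nonnegative and vanishes in the limit.\<close>
  have shift: "0 \<le> trunc_kernel t (real (Suc k)) x + t / real (Suc k)" for k x
    using trunc_kernel_ge[OF t, of "real (Suc k)" x] by simp
  have int: "integrable Q (trunc_kernel t (real (Suc k)))" for k
    by (rule integrable_trunc_kernel[OF t]) simp
  have nn: "(\<integral>\<^sup>+x. ennreal (trunc_kernel t (real (Suc k)) x + t / real (Suc k)) \<partial>Q) =
      ennreal (integral\<^sup>L Q (trunc_kernel t (real (Suc k))) + t / real (Suc k))" for k
  proof -
    have "(\<integral>\<^sup>+x. ennreal (trunc_kernel t (real (Suc k)) x + t / real (Suc k)) \<partial>Q) =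
        ennreal (\<integral>x. trunc_kernel t (real (Suc k)) x + t / real (Suc k) \<partial>Q)"
      using int shift by (intro nn_integral_eq_integral AE_I2 Bochner_Integration.integrable_add) simp_all
    then show ?thesis using int Q.prob_space by (simp del: of_nat_Suc)
  qed
  have inv: "(\<lambda>k. t / real (Suc k)) \<longlonglongrightarrow> 0"
    using tendsto_mult[OF tendsto_const LIMSEQ_inverse_real_of_nat, of t] by (simp add: divide_inverse)
  have lim_c: "(\<lambda>k. c + t / real (Suc k)) \<longlonglongrightarrow> c"
    using tendsto_add[OF tendsto_const inv, of c] by simp
  have "0 \<le> c"
  proof (rule LIMSEQ_le_const[OF lim_c])
    have "0 \<le> c + t / real (Suc k)" for k
    proof -
      have "0 \<le> (\<integral>x. trunc_kernel t (real (Suc k)) x + t / real (Suc k) \<partial>Q)"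
        using shift by (intro Bochner_Integration.integral_nonneg) simp
      also have "\<dots> = integral\<^sup>L Q (trunc_kernel t (real (Suc k))) + t / real (Suc k)"
        using int Q.prob_space by (simp del: of_nat_Suc)
      finally show ?thesis using le_c[of k] by linarith
    qed
    then show "\<exists>N. \<forall>k\<ge>N. 0 \<le> c + t / real (Suc k)" by blast
  qed
  have G: "(\<integral>\<^sup>+x. ennreal (t\<^sup>2 * exp_kernel (t * x)) \<partial>Q) \<le> ennreal c"
  proof (rule nn_integral_le_of_tendsto)
    show "(\<lambda>x. ennreal (trunc_kernel t (real (Suc k)) x + t / real (Suc k))) \<in> borel_measurable Q" for k
      by simp
    show "(\<integral>\<^sup>+x. ennreal (trunc_kernel t (real (Suc k)) x + t / real (Suc k)) \<partial>Q) \<le>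
        ennreal (c + t / real (Suc k))" for k
      unfolding nn using le_c[of k] by (intro ennreal_leI) simp
    show "(\<lambda>k. ennreal (c + t / real (Suc k))) \<longlonglongrightarrow> ennreal c"
      by (intro tendsto_ennrealI lim_c)
    fix x
    obtain k0 :: nat where k0: "x \<le> real k0" using real_arch_simple by blast
    have "eventually (\<lambda>k. trunc_kernel t (real (Suc k)) x = t\<^sup>2 * exp_kernel (t * x)) sequentially"
      using eventually_ge_at_top[of k0]
      by eventually_elim (use k0 in \<open>auto intro!: trunc_kernel_eq_exp_kernel\<close>)
    then have "(\<lambda>k. trunc_kernel t (real (Suc k)) x) \<longlonglongrightarrow> t\<^sup>2 * exp_kernel (t * x)"
      by (rule tendsto_eventually)
    from tendsto_add[OF this inv]
    show "(\<lambda>k. ennreal (trunc_kernel t (real (Suc k)) x + t / real (Suc k))) \<longlonglongrightarrow>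
        ennreal (t\<^sup>2 * exp_kernel (t * x))"
      by (intro tendsto_ennrealI) simp
  qed
  then show "(\<integral>\<^sup>+x. ennreal (t\<^sup>2 * exp_kernel (t * x)) \<partial>Q) < \<infinity>"
    by (rule le_less_trans) simp
  have "enn2real (\<integral>\<^sup>+x. ennreal (t\<^sup>2 * exp_kernel (t * x)) \<partial>Q) \<le> c"
    using G \<open>0 \<le> c\<close> by (rule enn2real_leI[rotated])
  then have "V * enn2real (\<integral>\<^sup>+x. ennreal (t\<^sup>2 * exp_kernel (t * x)) \<partial>Q) \<le> V * c"
    using V_pos by (intro mult_left_mono) simp_all
  also have "V * c = ln m" using V_pos by (simp add: c_def)
  finally have "exp (V * enn2real (\<integral>\<^sup>+x. ennreal (t\<^sup>2 * exp_kernel (t * x)) \<partial>Q)) \<le> m"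
    using m_pos by (simp only: ln_ge_iff)
  then show "ennreal (exp (V * enn2real (\<integral>\<^sup>+x. ennreal (t\<^sup>2 * exp_kernel (t * x)) \<partial>Q))) \<le>
      (\<integral>\<^sup>+x. ennreal (exp (t * x)) \<partial>\<mu>)"
    unfolding m by (rule ennreal_leI)
qed

text \<open>In the upper bound for \<open>min (exp (t x)) L\<close> the cap \<open>K\<close> has to be removed first, as the error
  \<open>L V / K\<^sup>2\<close> vanishes only for fixed \<open>L\<close>; then \<open>L \<rightarrow> \<infinity>\<close>.\<close>

lemma nn_integral_exp_le:
  assumes t: "0 \<le> t" and fin: "(\<integral>\<^sup>+x. ennreal (t\<^sup>2 * exp_kernel (t * x)) \<partial>Q) < \<infinity>"
  shows "(\<integral>\<^sup>+x. ennreal (exp (t * x)) \<partial>\<mu>) \<le>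
    ennreal (exp (V * enn2real (\<integral>\<^sup>+x. ennreal (t\<^sup>2 * exp_kernel (t * x)) \<partial>Q)))"
proof -
  define g where "g = enn2real (\<integral>\<^sup>+x. ennreal (t\<^sup>2 * exp_kernel (t * x)) \<partial>Q)"
  have nonneg: "0 \<le> t\<^sup>2 * exp_kernel (t * x)" for x
    by (intro mult_nonneg_nonneg exp_kernel_nonneg) simp
  have int: "integrable Q (\<lambda>x. t\<^sup>2 * exp_kernel (t * x))"
    using fin nonneg by (intro integrableI_nonneg) auto
  have g: "g = integral\<^sup>L Q (\<lambda>x. t\<^sup>2 * exp_kernel (t * x))"
    unfolding g_def using nonneg by (subst integral_eq_nn_integral) auto
  have le_g: "integral\<^sup>L Q (trunc_kernel t (real (Suc k))) \<le> g" for k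
    unfolding g
    by (intro integral_mono int integrable_trunc_kernel trunc_kernel_le_exp_kernel t) simp_all
  have trunc: "(\<integral>\<^sup>+x. ennreal (min (exp (t * x)) L) \<partial>\<mu>) \<le> ennreal (exp (V * g))" if L: "0 \<le> L" for L
  proof (rule LIMSEQ_le_const)
    have "(\<lambda>k. exp (V * g) + L * (V * (inverse (real (Suc k)))\<^sup>2)) \<longlonglongrightarrow> exp (V * g) + L * (V * 0\<^sup>2)"
      by (intro tendsto_intros LIMSEQ_inverse_real_of_nat)
    then show "(\<lambda>k. ennreal (exp (V * g) + L * (V / (real (Suc k))\<^sup>2))) \<longlonglongrightarrow> ennreal (exp (V * g))"
      by (intro tendsto_ennrealI) (simp add: divide_inverse power_inverse del: of_nat_Suc)
    have "(\<integral>\<^sup>+x. ennreal (min (exp (t * x)) L) \<partial>\<mu>) \<le> ennreal (exp (V * g) + L * (V / (real (Suc k))\<^sup>2))" for k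
    proof -
      have "(\<integral>\<^sup>+x. ennreal (min (exp (t * x)) L) \<partial>\<mu>) \<le>
          ennreal (exp (V * integral\<^sup>L Q (trunc_kernel t (real (Suc k)))) + L * (V / (real (Suc k))\<^sup>2))"
        by (rule nn_integral_min_exp_le[OF t _ L]) simp
      also have "\<dots> \<le> ennreal (exp (V * g) + L * (V / (real (Suc k))\<^sup>2))"
        using le_g[of k] V_pos by (intro ennreal_leI add_right_mono) simp
      finally show ?thesis .
    qed
    then show "\<exists>N. \<forall>k\<ge>N. (\<integral>\<^sup>+x. ennreal (min (exp (t * x)) L) \<partial>\<mu>) \<le>
        ennreal (exp (V * g) + L * (V / (real (Suc k))\<^sup>2))" by blast
  qed
  have "(\<integral>\<^sup>+x. ennreal (exp (t * x)) \<partial>\<mu>) \<le> ennreal (exp (V * g))"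
  proof (rule nn_integral_le_of_tendsto)
    show "(\<lambda>x. ennreal (min (exp (t * x)) (real k))) \<in> borel_measurable \<mu>" for k by simp
    show "(\<integral>\<^sup>+x. ennreal (min (exp (t * x)) (real k)) \<partial>\<mu>) \<le> ennreal (exp (V * g))" for k
      by (rule trunc) simp
    fix x
    obtain k0 :: nat where k0: "exp (t * x) \<le> real k0" using real_arch_simple by blast
    have "eventually (\<lambda>k. ennreal (min (exp (t * x)) (real k)) = ennreal (exp (t * x))) sequentially"
      using eventually_ge_at_top[of k0]
      by eventually_elim (use k0 in \<open>auto simp: min_absorb1\<close>)
    then show "(\<lambda>k. ennreal (min (exp (t * x)) (real k))) \<longlonglongrightarrow> ennreal (exp (t * x))"
      by (rule tendsto_eventually)
  qed simp
  then show ?thesis by (simp add: g_def)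
qed

lemma nn_integral_exp_eq:
  assumes "0 \<le> t"
  shows "(\<integral>\<^sup>+x. ennreal (exp (t * x)) \<partial>\<mu>) =
    (if (\<integral>\<^sup>+x. ennreal (t\<^sup>2 * exp_kernel (t * x)) \<partial>Q) = \<infinity> then \<infinity>
     else ennreal (exp (V * enn2real (\<integral>\<^sup>+x. ennreal (t\<^sup>2 * exp_kernel (t * x)) \<partial>Q))))"
proof (cases "(\<integral>\<^sup>+x. ennreal (t\<^sup>2 * exp_kernel (t * x)) \<partial>Q) < \<infinity>")
  case True
  have le: "(\<integral>\<^sup>+x. ennreal (exp (t * x)) \<partial>\<mu>) \<le>
      ennreal (exp (V * enn2real (\<integral>\<^sup>+x. ennreal (t\<^sup>2 * exp_kernel (t * x)) \<partial>Q)))"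
    by (rule nn_integral_exp_le[OF assms True])
  then have "(\<integral>\<^sup>+x. ennreal (exp (t * x)) \<partial>\<mu>) < \<infinity>" by (rule le_less_trans) simp
  from nn_integral_exp_finite_imp(2)[OF assms this] le
  have "(\<integral>\<^sup>+x. ennreal (exp (t * x)) \<partial>\<mu>) =
      ennreal (exp (V * enn2real (\<integral>\<^sup>+x. ennreal (t\<^sup>2 * exp_kernel (t * x)) \<partial>Q)))"
    by (intro antisym)
  then show ?thesis using True by (simp only: less_irrefl if_False split: if_split) auto
next
  case False
  then have "\<not> (\<integral>\<^sup>+x. ennreal (exp (t * x)) \<partial>\<mu>) < \<infinity>"
    using nn_integral_exp_finite_imp(1)[OF assms] by blast
  then show ?thesis using False by (simp add: less_top [symmetric])
qed

end

section \<open>From the Levy-Khintchine triplet to the laws of \<open>Z\<close> and \<open>R\<close>\<close>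

text \<open>That the law of \<open>Z\<close> has mass 1 encodes the identity \<open>V = a + \<integral> x\<^sup>2 \<nu>(dx)\<close>, hence the
  integrability of \<open>x\<^sup>2\<close>. So the jumps outside \<open>[-1, 1]\<close> can be compensated as well, which changes
  the drift to \<open>m\<close>; then \<open>m = 0\<close> because the law is centered.\<close>

lemma centered_id_law_of_levy_triplet:
  assumes \<mu>: "real_distribution \<mu>" and inf_div: "infinitely_divisible \<mu>"
    and sq: "integrable \<mu> (\<lambda>x. x\<^sup>2)" and mean: "integral\<^sup>L \<mu> (\<lambda>x. x) = 0"
    and var: "integral\<^sup>L \<mu> (\<lambda>x. x\<^sup>2) = V" "0 < V"
    and triplet: "has_levy_triplet \<mu> b a \<nu>"
    and Q: "prob_space Q" "Q = scale_measure (ennreal (1 / V)) (levy_H a \<nu>)"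
  shows "centered_id_law \<mu> Q V"
proof -
  interpret real_distribution \<mu> by (rule \<mu>)
  interpret Q: prob_space Q by (rule Q)
  have a: "0 \<le> a" and \<nu>: "sets \<nu> = sets borel"
    and char: "char \<mu> u = exp (\<i> * complex_of_real (b * u) - complex_of_real (a * u\<^sup>2 / 2)
      + (CLINT x|\<nu>. iexp (u * x) - 1 - \<i> * complex_of_real (u * x * indicator {-1..1} x)))" for u
    using triplet by (auto simp: has_levy_triplet_def levy_measure_def)
  have [measurable_cong]: "sets \<nu> = sets borel" by (rule \<nu>)
  have sets_Q [simp]: "sets Q = sets borel" by (simp add: Q(2))
  have Q_dist: "real_distribution Q"
    using Q(1) sets_eq_imp_space_eq[OF sets_Q] by (simp add: real_distribution_def real_distribution_axioms_def)
  interpret Q: real_distribution Q by (rule Q_dist)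
  let ?D = "density (return borel (0::real)) (\<lambda>_. ennreal (a / V))"
  let ?E = "density \<nu> (\<lambda>x. ennreal (x\<^sup>2 / V))"
  have Q_sum: "emeasure Q A = emeasure ?D A + emeasure ?E A" if "A \<in> sets Q" for A
  proof -
    have A [measurable]: "A \<in> sets borel" using that by simp
    have "ennreal (1 / V) * (\<integral>\<^sup>+x\<in>A. ennreal (x\<^sup>2) \<partial>\<nu>) =
        (\<integral>\<^sup>+x. ennreal (1 / V) * (ennreal (x\<^sup>2) * indicator A x) \<partial>\<nu>)"
      by (rule nn_integral_cmult [symmetric]) measurable
    also have "\<dots> = emeasure ?E A"
      using A \<nu> var by (subst emeasure_density) (auto intro!: nn_integral_cong simp: mult.assoc [symmetric] ennreal_mult' [symmetric])
    finally have E: "ennreal (1 / V) * (\<integral>\<^sup>+x\<in>A. ennreal (x\<^sup>2) \<partial>\<nu>) = emeasure ?E A" .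
    have "emeasure ?D A = ennreal (1 / V) * (ennreal a * indicator A 0)"
      using A a var by (simp add: emeasure_density nn_integral_cmult ennreal_mult' [symmetric] mult.assoc [symmetric])
    with E show ?thesis
      unfolding Q(2) by (simp add: emeasure_levy_H[OF \<nu> A] distrib_left)
  qed
  have int_sq: "integrable \<nu> (\<lambda>x. x\<^sup>2)"
  proof -
    have "integrable Q (\<lambda>_. 1::real)" by simp
    from integrable_of_measure_sum(2)[OF this _ _ Q_sum]
    have "integrable ?E (\<lambda>_. 1::real)" by (simp add: \<nu>)
    then have "integrable \<nu> (\<lambda>x. x\<^sup>2 / V)"
      using var by (subst (asm) integrable_density) auto
    from integrable_mult_right[OF this, of V] show ?thesis using var by simp
  qed
  have kernel: "complex_of_real V * integral\<^sup>L Q (levy_kernel u) =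
      - complex_of_real (a * u\<^sup>2 / 2) + (CLINT x|\<nu>. iexp (u * x) - 1 - \<i> * complex_of_real (u * x))" for u
  proof -
    have kernel_0: "levy_kernel u 0 = - complex_of_real (u\<^sup>2 / 2)" by (simp add: levy_kernel_def)
    have "integral\<^sup>L Q (levy_kernel u) = integral\<^sup>L ?D (levy_kernel u) + integral\<^sup>L ?E (levy_kernel u)"
      by (rule integral_measure_sum[OF Q.integrable_levy_kernel _ _ Q_sum]) (simp_all add: \<nu>)
    also have "integral\<^sup>L ?D (levy_kernel u) = (a / V) *\<^sub>R levy_kernel u 0"
      using a var by (subst integral_density) (auto simp: integral_return)
    also have "integral\<^sup>L ?E (levy_kernel u) = (CLINT x|\<nu>. (x\<^sup>2 / V) *\<^sub>R levy_kernel u x)"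
      using var by (intro integral_density) auto
    also have "\<dots> = (CLINT x|\<nu>. (1 / V) *\<^sub>R (iexp (u * x) - 1 - \<i> * complex_of_real (u * x)))"
      by (simp only: levy_kernel_mult_square [symmetric]) (simp add: scaleR_conv_of_real)
    also have "\<dots> = (1 / V) *\<^sub>R (CLINT x|\<nu>. iexp (u * x) - 1 - \<i> * complex_of_real (u * x))"
      by (rule integral_scaleR_right)
    finally show ?thesis
      using var by (simp add: scaleR_conv_of_real kernel_0 field_simps)
  qed
  define m where "m = b + (LINT x|\<nu>. x * indicator (- {-1..1}) x)"
  have char_m: "char \<mu> u = exp (\<i> * complex_of_real (m * u) + complex_of_real V * integral\<^sup>L Q (levy_kernel u))" for u
  proof -
    have int_tail: "integrable \<nu> (\<lambda>x. x * indicator (- {-1..1}) x)"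
    proof (rule Bochner_Integration.integrable_bound[OF int_sq])
      have "\<bar>x\<bar> \<le> x\<^sup>2" if "x \<notin> {-1..1}" for x :: real
      proof -
        have "1 * \<bar>x\<bar> \<le> \<bar>x\<bar> * \<bar>x\<bar>" using that by (intro mult_right_mono) auto
        then show ?thesis by (simp add: power2_eq_square)
      qed
      then show "AE x in \<nu>. norm (x * indicator (- {-1..1}) x) \<le> norm (x\<^sup>2)"
        by (intro AE_I2) (auto simp: indicator_def)
    qed measurable
    have int_rem: "integrable \<nu> (\<lambda>x. iexp (u * x) - 1 - \<i> * complex_of_real (u * x))"
    proof (rule Bochner_Integration.integrable_bound)
      show "integrable \<nu> (\<lambda>x. u\<^sup>2 * x\<^sup>2 / 2)" using int_sq by simp
      have "norm (iexp (u * x) - 1 - \<i> * complex_of_real (u * x)) \<le> norm (u\<^sup>2 * x\<^sup>2 / 2)" for x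
        using norm_iexp_remainder_le[of "u * x"]
          by (simp only: power_mult_distrib real_norm_def order_trans[OF _ abs_ge_self])
      then show "AE x in \<nu>. norm (iexp (u * x) - 1 - \<i> * complex_of_real (u * x)) \<le> norm (u\<^sup>2 * x\<^sup>2 / 2)"
        by (intro AE_I2)
    qed measurable
    have int_tail': "integrable \<nu> (\<lambda>x. (\<i> * complex_of_real u) * complex_of_real (x * indicator (- {-1..1}) x))"
      by (intro integrable_mult_right integrable_of_real int_tail)
    have "(CLINT x|\<nu>. iexp (u * x) - 1 - \<i> * complex_of_real (u * x * indicator {-1..1} x)) =
        (CLINT x|\<nu>. (iexp (u * x) - 1 - \<i> * complex_of_real (u * x)) +
          (\<i> * complex_of_real u) * complex_of_real (x * indicator (- {-1..1}) x))"
      by (intro Bochner_Integration.integral_cong refl) (auto simp: indicator_def)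
    also have "\<dots> = (CLINT x|\<nu>. iexp (u * x) - 1 - \<i> * complex_of_real (u * x)) +
        (CLINT x|\<nu>. (\<i> * complex_of_real u) * complex_of_real (x * indicator (- {-1..1}) x))"
      by (rule Bochner_Integration.integral_add[OF int_rem int_tail'])
    also have "(CLINT x|\<nu>. (\<i> * complex_of_real u) * complex_of_real (x * indicator (- {-1..1}) x)) =
        (\<i> * complex_of_real u) * complex_of_real (LINT x|\<nu>. x * indicator (- {-1..1}) x)"
      by (simp only: integral_mult_right_zero integral_complex_of_real)
    finally show ?thesis
      unfolding char kernel m_def by (simp add: algebra_simps)
  qed
  have "m = 0"
  proof (rule centered_drift_eq_0[OF sq mean char_m])
    fix u
    have "norm (integral\<^sup>L Q (levy_kernel u)) \<le> (LINT x|Q. norm (levy_kernel u x))"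
      by (rule integral_norm_bound)
    also have "\<dots> \<le> (LINT x|Q. u\<^sup>2 / 2)"
      by (intro integral_mono integrable_norm Q.integrable_levy_kernel norm_levy_kernel_le) simp
    also have "\<dots> = u\<^sup>2 / 2" using Q.prob_space by simp
    finally have "V * norm (integral\<^sup>L Q (levy_kernel u)) \<le> V * (u\<^sup>2 / 2)"
      using var by (intro mult_left_mono) simp_all
    then show "norm (complex_of_real V * integral\<^sup>L Q (levy_kernel u)) \<le> V / 2 * u\<^sup>2"
      using var by (simp add: norm_mult)
  qed
  then show ?thesis
    using assms char_m Q_dist by (simp add: centered_id_law_def centered_id_law_axioms_def)
qed

lemma (in prob_space) mgf_beta_product:
  assumes B: "distributed M lborel B (\<lambda>x. ennreal (2 * (1 - x) * indicator {0<..<1} x))"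
    and indep: "indep_var borel B borel Z"
  shows "mgf M (\<lambda>\<omega>. B \<omega> * Z \<omega>) t = (\<integral>\<^sup>+z. ennreal (2 * exp_kernel (t * z)) \<partial>distr M borel Z)"
proof -
  have [measurable]: "B \<in> borel_measurable M" "Z \<in> borel_measurable M"
    using indep by (auto dest: indep_var_rv1 indep_var_rv2)
  let ?DB = "distr M borel B" and ?DZ = "distr M borel Z"
  interpret DB: prob_space ?DB by (rule prob_space_distr) measurable
  interpret DZ: prob_space ?DZ by (rule prob_space_distr) measurable
  interpret DBZ: pair_prob_space ?DB ?DZ ..
  have DB: "?DB = density lborel (\<lambda>x. ennreal (2 * (1 - x) * indicator {0<..<1} x))"
    using distributed_distr_eq_density[OF B] distr_cong[of M M borel lborel B B] by simp
  have "mgf M (\<lambda>\<omega>. B \<omega> * Z \<omega>) t =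
      (\<integral>\<^sup>+p. ennreal (exp (t * (fst p * snd p))) \<partial>distr M (borel \<Otimes>\<^sub>M borel) (\<lambda>\<omega>. (B \<omega>, Z \<omega>)))"
    unfolding mgf_def by (subst nn_integral_distr) simp_all
  also have "distr M (borel \<Otimes>\<^sub>M borel) (\<lambda>\<omega>. (B \<omega>, Z \<omega>)) = ?DB \<Otimes>\<^sub>M ?DZ"
    using indep unfolding indep_var_distribution_eq by simp
  also have "(\<integral>\<^sup>+p. ennreal (exp (t * (fst p * snd p))) \<partial>(?DB \<Otimes>\<^sub>M ?DZ)) =
      (\<integral>\<^sup>+z. \<integral>\<^sup>+x. ennreal (exp (t * (x * z))) \<partial>?DB \<partial>?DZ)"
    by (subst DBZ.nn_integral_snd [symmetric]) (simp_all add: split_beta')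
  also have "\<dots> = (\<integral>\<^sup>+z. ennreal (2 * exp_kernel (t * z)) \<partial>?DZ)"
  proof (rule nn_integral_cong)
    fix z
    have "(\<integral>\<^sup>+x. ennreal (exp (t * (x * z))) \<partial>?DB) =
        (\<integral>\<^sup>+x. ennreal (2 * (1 - x) * indicator {0<..<1} x) * ennreal (exp (x * (t * z))) \<partial>lborel)"
      unfolding DB by (subst nn_integral_density) (simp_all add: mult_ac)
    then show "(\<integral>\<^sup>+x. ennreal (exp (t * (x * z))) \<partial>?DB) = ennreal (2 * exp_kernel (t * z))"
      by (simp only: nn_integral_beta_exp)
  qed
  finally show ?thesis .
qed

section \<open>The feasible pairs\<close>

text \<open>Write \<open>q\<close> for the value of the moment generating function of \<open>R\<close>. For \<open>c t < 1\<close> the bound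
  \<open>V t\<^sup>2 q / 2 \<le> v t\<^sup>2 / (2 (1 - c t))\<close> rearranges to \<open>\<Psi>(t) \<le> c\<close>. For \<open>c t \<ge> 1\<close> feasibility imposes
  no condition, and \<open>\<Psi>(t) \<le> 1 / t \<le> c\<close> holds anyway. If \<open>q = \<infinity>\<close>, then \<open>\<Psi>(t) = 1 / t\<close>, and
  \<open>c t < 1\<close> is ruled out on both sides.\<close>

lemma feasible_iff_Psi_le:
  assumes V: "0 < V" and v: "0 < v"
    and X0: "mgf M X 0 = 1"
    and pos: "\<And>t. 0 < t \<Longrightarrow> mgf N R t \<noteq> 0"
    and mgf: "\<And>t. 0 < t \<Longrightarrow> mgf M X t =
      (if mgf N R t = \<infinity> then \<infinity> else ennreal (exp (V * t\<^sup>2 / 2 * enn2real (mgf N R t))))"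
  shows "feasible M X v c \<longleftrightarrow> 0 \<le> c \<and> (\<forall>t>0. Psi N R (v / V) t \<le> ereal c)"
proof -
  have at_0: "cgf M X 0 \<le> ereal (v * 0\<^sup>2 / (2 * (1 - c * 0)))"
    by (simp add: cgf_def X0)
  have key: "((c = 0 \<or> t < 1 / c) \<longrightarrow> cgf M X t \<le> ereal (v * t\<^sup>2 / (2 * (1 - c * t)))) \<longleftrightarrow>
      Psi N R (v / V) t \<le> ereal c" if t: "0 < t" and c: "0 \<le> c" for t
  proof -
    have dom: "(c = 0 \<or> t < 1 / c) \<longleftrightarrow> c * t < 1"
      using c by (cases "c = 0") (simp_all add: pos_less_divide_eq mult.commute)
    show ?thesis
    proof (cases "mgf N R t" rule: ennreal_cases)
      case (real q)
      then have q: "0 < q" using pos[OF t] by (cases "q = 0") auto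
      have "cgf M X t = ereal (V * t\<^sup>2 / 2 * q)"
        using real mgf[OF t] by (simp add: cgf_def)
      moreover have Psi: "Psi N R (v / V) t = ereal ((1 - v / V / q) / t)"
        using real q t by (simp add: Psi_def one_ereal_def)
      moreover have "V * t\<^sup>2 / 2 * q \<le> v * t\<^sup>2 / (2 * (1 - c * t)) \<longleftrightarrow> (1 - v / V / q) / t \<le> c"
        if "c * t < 1"
      proof -
        have "V * t\<^sup>2 / 2 * q \<le> v * t\<^sup>2 / (2 * (1 - c * t)) \<longleftrightarrow> (t\<^sup>2 / 2) * (V * q * (1 - c * t)) \<le> (t\<^sup>2 / 2) * v"
        proof -
          have "v * t\<^sup>2 / (2 * (1 - c * t)) = (t\<^sup>2 / 2 * v) / (1 - c * t)" by simp
          moreover have "0 < 1 - c * t" using that by simp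
          moreover have "V * t\<^sup>2 / 2 * q * (1 - c * t) = t\<^sup>2 / 2 * (V * q * (1 - c * t))" by simp
          ultimately show ?thesis by (simp only: pos_le_divide_eq)
        qed
        also have "\<dots> \<longleftrightarrow> V * q * (1 - c * t) \<le> v"
          using t by (intro mult_le_cancel_left_pos) simp
        also have "\<dots> \<longleftrightarrow> 1 - c * t \<le> v / V / q"
          using V q by (simp add: pos_le_divide_eq mult_ac)
        also have "\<dots> \<longleftrightarrow> (1 - v / V / q) / t \<le> c"
          using t by (simp add: pos_divide_le_eq algebra_simps)
        finally show ?thesis .
      qed
      moreover have "(1 - v / V / q) / t \<le> c" if "\<not> c * t < 1"
      proof -
        have "1 - v / V / q \<le> c * t" using that V v q by (smt (verit) divide_pos_pos)
        then show ?thesis using t by (simp add: pos_divide_le_eq)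
      qed
      ultimately show ?thesis unfolding dom by auto
    next
      case top
      have "cgf M X t = \<infinity>" using top mgf[OF t] by (simp add: cgf_def)
      moreover have "Psi N R (v / V) t = ereal (1 / t)"
        using top t by (simp add: Psi_def one_ereal_def)
      moreover have "1 / t \<le> c \<longleftrightarrow> \<not> c * t < 1" using t by (auto simp: pos_divide_le_eq)
      ultimately show ?thesis unfolding dom by auto
    qed
  qed
  show ?thesis
    unfolding feasible_def using v key at_0 by (metis less_eq_real_def)
qed

text \<open>For \<open>C = \<infinity>\<close> the set is empty, and the infimum of the empty set is \<open>\<infinity>\<close>.\<close>

lemma Inf_ereal_above:
  fixes C :: ereal
  assumes "0 \<le> C"
  shows "Inf {ereal c |c. C \<le> ereal c} = C"
proof (cases C)
  case (real r)
  then show ?thesis by (intro Inf_eqI) auto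
next
  case PInf
  then show ?thesis by (auto simp: top_ereal_def)
qed (use assms in auto)

theorem theorem3p3:
  fixes M :: "'a measure" and X :: "'a \<Rightarrow> real"
    and N :: "'b measure" and B Z :: "'b \<Rightarrow> real"
    and V a b v :: real and \<nu> :: "real measure"
  assumes M: "prob_space M"
    and X: "X \<in> borel_measurable M"
    and square_integrable: "integrable M (\<lambda>\<omega>. (X \<omega>)\<^sup>2)"
    and centered: "prob_space.expectation M X = 0"
    and V: "V = prob_space.variance M X" "V > 0"
    and inf_div: "infinitely_divisible (distr M borel X)"
    and triplet: "has_levy_triplet (distr M borel X) b a \<nu>"
    and N: "prob_space N"
    and B: "distributed N lborel B (\<lambda>x. ennreal (2 * (1 - x) * indicator {0<..<1} x))"
    and Z: "Z \<in> borel_measurable N"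
      "distr N borel Z = scale_measure (ennreal (1 / V)) (levy_H a \<nu>)"
    and indep: "prob_space.indep_var N borel B borel Z"
    and v: "v > 0"
  shows "let C = max 0 (SUP t\<in>{0<..}. Psi N (\<lambda>\<omega>. B \<omega> * Z \<omega>) (v / V) t) in
    c_star M X v = C \<and>
    (C < \<infinity> \<longrightarrow>
      feasible M X v (real_of_ereal C) \<and>
      (\<forall>c. feasible M X v c \<longrightarrow> real_of_ereal C \<le> c))"
proof -
  interpret M: prob_space M by (rule M)
  interpret N: prob_space N by (rule N)
  note [measurable] = X Z(1)
  let ?R = "\<lambda>\<omega>. B \<omega> * Z \<omega>" and ?Q = "distr N borel Z"
  have B_meas [measurable]: "B \<in> borel_measurable N"
    using indep by (rule N.indep_var_rv1)
  \<comment> \<open>The Levy-Khintchine formula for the law of \<open>X\<close> becomes one with mixing law that of \<open>Z\<close>.\<close>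
  interpret law: centered_id_law "distr M borel X" ?Q V
  proof (rule centered_id_law_of_levy_triplet[OF _ inf_div _ _ _ V(2) triplet _ Z(2)])
    show "real_distribution (distr M borel X)" by (rule M.real_distribution_distr) simp
    show "integrable (distr M borel X) (\<lambda>x. x\<^sup>2)"
      using square_integrable by (simp add: integrable_distr_eq)
    show "integral\<^sup>L (distr M borel X) (\<lambda>x. x) = 0"
      using centered by (simp add: integral_distr)
    show "integral\<^sup>L (distr M borel X) (\<lambda>x. x\<^sup>2) = V"
      using V(1) centered by (simp add: integral_distr)
    show "prob_space ?Q" by (rule N.prob_space_distr) simp
  qed
  have mgf_R: "mgf N ?R t = (\<integral>\<^sup>+z. ennreal (2 * exp_kernel (t * z)) \<partial>?Q)" for t
    by (rule N.mgf_beta_product[OF B indep])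
  have scale: "(\<integral>\<^sup>+z. ennreal (t\<^sup>2 * exp_kernel (t * z)) \<partial>?Q) = ennreal (t\<^sup>2 / 2) * mgf N ?R t" for t
  proof -
    have "ennreal (t\<^sup>2 / 2) * mgf N ?R t = (\<integral>\<^sup>+z. ennreal (t\<^sup>2 / 2) * ennreal (2 * exp_kernel (t * z)) \<partial>?Q)"
      unfolding mgf_R by (rule nn_integral_cmult [symmetric]) simp
    then show ?thesis by (simp add: ennreal_mult' [symmetric])
  qed
  \<comment> \<open>This is \<open>K\<^sub>X(t) = V t\<^sup>2 M\<^sub>R(t) / 2\<close>, with both sides infinite at the same time.\<close>
  have mgf_X: "mgf M X t =
      (if mgf N ?R t = \<infinity> then \<infinity> else ennreal (exp (V * t\<^sup>2 / 2 * enn2real (mgf N ?R t))))"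
    if t: "0 < t" for t
  proof -
    have "mgf M X t = (\<integral>\<^sup>+x. ennreal (exp (t * x)) \<partial>distr M borel X)"
      unfolding mgf_def by (subst nn_integral_distr) simp_all
    moreover have "ennreal (t\<^sup>2 / 2) * mgf N ?R t = \<infinity> \<longleftrightarrow> mgf N ?R t = \<infinity>"
      using t by (auto simp: ennreal_mult_eq_top_iff)
    ultimately show ?thesis
      unfolding law.nn_integral_exp_eq[OF less_imp_le[OF t]] scale
      by (simp add: enn2real_mult)
  qed
  have pos: "mgf N ?R t \<noteq> 0" for t
  proof
    assume "mgf N ?R t = 0"
    then have "AE \<omega> in N. ennreal (exp (t * ?R \<omega>)) = 0"
      unfolding mgf_def by (subst (asm) nn_integral_0_iff_AE) simp_all
    then show False using N.emeasure_space_1 by (simp add: AE_iff_null_sets null_sets_def)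
  qed
  have "mgf M X 0 = 1" by (simp add: mgf_def M.emeasure_space_1)
  from feasible_iff_Psi_le[OF V(2) v this pos mgf_X]
  have feasible: "feasible M X v c \<longleftrightarrow> 0 \<le> c \<and> (\<forall>t>0. Psi N ?R (v / V) t \<le> ereal c)" for c .
  define C where "C = max 0 (SUP t\<in>{0<..}. Psi N ?R (v / V) t)"
  have feasible_iff: "feasible M X v c \<longleftrightarrow> C \<le> ereal c" for c
    unfolding feasible C_def by (auto simp: SUP_le_iff)
  have C0: "0 \<le> C" by (simp add: C_def)
  have "c_star M X v = C"
    unfolding c_star_def feasible_iff using C0 by (rule Inf_ereal_above)
  moreover have "feasible M X v (real_of_ereal C)"
    and "\<forall>c. feasible M X v c \<longrightarrow> real_of_ereal C \<le> c" if "C < \<infinity>"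
    using that C0 unfolding feasible_iff by (cases C; auto)+
  ultimately show ?thesis unfolding C_def [symmetric] Let_def by blast
qed

end
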